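(* Let $m\ge 2$ be an even integer and $n\ge 1$ an integer. A cyclic and $\phi_n$-symmetric hamiltonian cycle system of $K_{m\times n}$ exists if and only if $n$ is even and, whenever $n\equiv 2\pmod 4$, also $m\equiv 2\pmod 4$.
   Context: $K_{m\times n}$ is the complete multipartite graph with $m$ parts of size $n$. Identify its vertex set with $\mathbb{Z}_{mn}$, the parts being the cosets of the subgroup $m\mathbb{Z}_{mn}$ (of order $n$); two vertices $x,y$ are adjacent iff $x-y\notin m\mathbb{Z}_{mn}$. A hamiltonian cycle system (HCS) of a graph is a set of cycles through all vertices whose edge sets partition the edge set of the graph. An HCS of $K_{m\times n}$ is cyclic if whenever $(c_0,\dots,c_{\ell-1})$ is a cycle of the system, so is $(c_0+1,\dots,c_{\ell-1}+1)$. Let $\phi_n$ be the permutation $x\mapsto x+m$ of $\mathbb{Z}_{mn}$ (a fixed-point-free automorphism of $K_{m\times n}$ of order $n$). An HCS is $\phi_n$-symmetric if every cycle of the system is mapped to itself by $\phi_n$. *)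

theory Defs
  imports Main "HOL-Library.Disjoint_Sets"
begin

text \<open>
  A graph is given by its vertex set \<open>V\<close> and its set \<open>E\<close> of edges, each edge being a two-element set
  of vertices.  A cycle \<open>(c\<^sub>0, \<dots>, c\<^sub>l\<^sub>-\<^sub>1)\<close> is written as a list; lists that differ by a
  rotation or a reversal denote the same cycle, so as a member of a cycle system a cycle is
  represented by its edge set.
\<close>

definition cycle_edges :: "'a list \<Rightarrow> 'a set set" where
  "cycle_edges c = {{c ! i, c ! (Suc i mod length c)} | i. i < length c}"

definition hamiltonian_cycle :: "'a set \<Rightarrow> 'a set set \<Rightarrow> 'a list \<Rightarrow> bool" where
  "hamiltonian_cycle V E c \<longleftrightarrow>
     length c \<ge> 3 \<and> distinct c \<and> set c = V \<and> cycle_edges c \<subseteq> E"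

definition hamiltonian_cycle_system :: "'a set \<Rightarrow> 'a set set \<Rightarrow> 'a set set set \<Rightarrow> bool" where
  "hamiltonian_cycle_system V E \<H> \<longleftrightarrow>
     (\<forall>X\<in>\<H>. \<exists>c. hamiltonian_cycle V E c \<and> X = cycle_edges c) \<and> partition_on E \<H>"

text \<open>
  The group of integers modulo \<open>m * n\<close> is represented by the residues \<open>0, \<dots>, m * n - 1\<close>.
\<close>

definition multipartite_verts :: "nat \<Rightarrow> nat \<Rightarrow> int set" where
  "multipartite_verts m n = {0..<int (m * n)}"

definition part_subgroup :: "nat \<Rightarrow> nat \<Rightarrow> int set" where
  "part_subgroup m n = {int m * k mod int (m * n) | k. k \<in> multipartite_verts m n}"

definition multipartite_edges :: "nat \<Rightarrow> nat \<Rightarrow> int set set" where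
  "multipartite_edges m n =
     {{x, y} | x y. x \<in> multipartite_verts m n \<and> y \<in> multipartite_verts m n \<and>
                    (x - y) mod int (m * n) \<notin> part_subgroup m n}"

definition translate :: "nat \<Rightarrow> nat \<Rightarrow> int \<Rightarrow> int \<Rightarrow> int" where
  "translate m n t x = (x + t) mod int (m * n)"

definition phi :: "nat \<Rightarrow> nat \<Rightarrow> int \<Rightarrow> int" where
  "phi m n = translate m n (int m)"

definition multipartite_hcs :: "nat \<Rightarrow> nat \<Rightarrow> int set set set \<Rightarrow> bool" where
  "multipartite_hcs m n \<H> \<longleftrightarrow>
     hamiltonian_cycle_system (multipartite_verts m n) (multipartite_edges m n) \<H>"

definition cyclic_hcs :: "nat \<Rightarrow> nat \<Rightarrow> int set set set \<Rightarrow> bool" where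
  "cyclic_hcs m n \<H> \<longleftrightarrow> multipartite_hcs m n \<H> \<and>
     (\<forall>c. hamiltonian_cycle (multipartite_verts m n) (multipartite_edges m n) c \<and>
          cycle_edges c \<in> \<H> \<longrightarrow> cycle_edges (map (translate m n 1) c) \<in> \<H>)"

definition phi_symmetric_hcs :: "nat \<Rightarrow> nat \<Rightarrow> int set set set \<Rightarrow> bool" where
  "phi_symmetric_hcs m n \<H> \<longleftrightarrow> multipartite_hcs m n \<H> \<and>
     (\<forall>c. hamiltonian_cycle (multipartite_verts m n) (multipartite_edges m n) c \<and>
          cycle_edges c \<in> \<H> \<longrightarrow> cycle_edges (map (phi m n) c) = cycle_edges c)"

end

theory Submission
  imports Defs
begin

text \<open>
  Let \<open>N = m * n\<close>.  Necessity: counting edges at a vertex shows that the system has \<open>(m - 1) * n / 2\<close>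
  cycles, so \<open>n\<close> is even.  Then translations permute each cycle they fix by rotations.  A cycle whose
  translation orbit has length \<open>d\<close> satisfies \<open>c\<^sub>i\<^sub>+\<^sub>d = c\<^sub>i + d * w\<close> with \<open>w\<close> prime to \<open>N / d\<close>, so one period
  contains a number of odd differences of the parity of \<open>d\<close>.  Summing over all orbits, \<open>N / 4\<close>, the number
  of odd differences up to sign, has the parity of the number of cycles.

  Sufficiency: it is enough to give base cycles whose differences cover each element outside the
  parts exactly once up to sign.  With \<open>m = 2 * M\<close>, a zigzag through the even residues modulo \<open>m\<close> uses one even
  difference from each of \<open>M - 1\<close> classes, and \<open>n / 2\<close> zigzags use up all even differences.  Two zigzags,
  one on the even and one on the odd residues, are joined by two odd differences to a base cycle of
  period \<open>m\<close>; if \<open>n / 2\<close> is odd, one zigzag is left and closes up to a base cycle of period \<open>M\<close>.  The remaining odd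
  differences are paired as \<open>2 * p + 1, 2 * p + 3\<close>, each pair giving a base cycle of period \<open>2\<close>.
\<close>

section \<open>Cycles and their automorphisms\<close>

text \<open>Indices range over all integers modulo the length, so rotations and reflections of a
  cycle become affine maps of the index and no wrap-around case arises.\<close>

definition cyc_nth :: "'a list \<Rightarrow> int \<Rightarrow> 'a" where
  "cyc_nth c i = c ! nat (i mod int (length c))"

lemma cyc_nth_mod: "cyc_nth c (i mod int (length c)) = cyc_nth c i"
  by (simp add: cyc_nth_def)

lemma cyc_nth_cong: "i mod int (length c) = j mod int (length c) \<Longrightarrow> cyc_nth c i = cyc_nth c j"
  by (simp add: cyc_nth_def)

lemma cyc_nth_of_nat: "i < length c \<Longrightarrow> cyc_nth c (int i) = c ! i"
  by (simp add: cyc_nth_def)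

lemma cyc_nth_in_set: "c \<noteq> [] \<Longrightarrow> cyc_nth c i \<in> set c"
  by (simp add: cyc_nth_def nat_less_iff)

lemma cyc_nth_eq_iff:
  assumes "distinct c" and "c \<noteq> []"
  shows "cyc_nth c i = cyc_nth c j \<longleftrightarrow> i mod int (length c) = j mod int (length c)"
proof -
  have "nat (i mod int (length c)) < length c" "nat (j mod int (length c)) < length c"
    using assms by (simp_all add: nat_less_iff)
  then show ?thesis
    using assms by (simp add: cyc_nth_def nth_eq_iff_index_eq eq_nat_nat_iff)
qed

lemma cyc_nth_surj:
  assumes "x \<in> set c"
  obtains i where "i < length c" and "x = cyc_nth c (int i)"
  using assms by (metis cyc_nth_of_nat in_set_conv_nth)

lemma cycle_edges_eq_image:
  "cycle_edges c = (\<lambda>i. {cyc_nth c (int i), cyc_nth c (int i + 1)}) ` {..<length c}"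
proof -
  have "c ! (Suc i mod length c) = cyc_nth c (int i + 1)" if "i < length c" for i
  proof -
    have "(int i + 1) mod int (length c) = int (Suc i mod length c)"
      by (simp add: zmod_int add.commute)
    then show ?thesis by (simp add: cyc_nth_def)
  qed
  then show ?thesis
    by (fastforce simp: cycle_edges_def cyc_nth_of_nat)
qed

lemma cycle_edges_eq_range:
  assumes "c \<noteq> []"
  shows "cycle_edges c = range (\<lambda>i. {cyc_nth c i, cyc_nth c (i + 1)})"
proof
  show "cycle_edges c \<subseteq> range (\<lambda>i. {cyc_nth c i, cyc_nth c (i + 1)})"
    by (auto simp: cycle_edges_eq_image)
  show "range (\<lambda>i. {cyc_nth c i, cyc_nth c (i + 1)}) \<subseteq> cycle_edges c"
  proof clarify
    fix i :: int
    let ?k = "nat (i mod int (length c))"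
    have k: "int ?k = i mod int (length c)" "?k < length c"
      using assms by (simp_all add: nat_less_iff)
    have "cyc_nth c i = cyc_nth c (int ?k)" "cyc_nth c (i + 1) = cyc_nth c (int ?k + 1)"
      unfolding k(1) by (rule cyc_nth_cong; simp add: mod_simps)+
    then show "{cyc_nth c i, cyc_nth c (i + 1)} \<in> cycle_edges c"
      using k(2) unfolding cycle_edges_eq_image by (intro image_eqI[of _ _ ?k]) simp_all
  qed
qed

lemma cycle_edges_map: "cycle_edges (map f c) = image f ` cycle_edges c"
proof -
  have *: "Suc i mod length c < length c" if "i < length c" for i
    using that by (metis mod_less_divisor not_less_zero neq0_conv)
  have "cycle_edges c = (\<lambda>i. {c ! i, c ! (Suc i mod length c)}) ` {..<length c}"
    "cycle_edges (map f c) = (\<lambda>i. {map f c ! i, map f c ! (Suc i mod length c)}) ` {..<length c}"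
    by (auto simp: cycle_edges_def simp del: nth_map)
  then show ?thesis
    using * by (simp add: image_image)
qed

lemma cyc_nth_neighbour:
  assumes "distinct c" and "c \<noteq> []" and "{cyc_nth c i, y} \<in> cycle_edges c"
  shows "y = cyc_nth c (i + 1) \<or> y = cyc_nth c (i - 1)"
proof -
  obtain j where "{cyc_nth c i, y} = {cyc_nth c j, cyc_nth c (j + 1)}"
    using assms cycle_edges_eq_range by blast
  then consider "cyc_nth c i = cyc_nth c j" "y = cyc_nth c (j + 1)"
    | "cyc_nth c i = cyc_nth c (j + 1)" "y = cyc_nth c j"
    by (auto simp: doubleton_eq_iff)
  then show ?thesis
  proof cases
    case 1
    then have "i mod int (length c) = j mod int (length c)"
      using assms cyc_nth_eq_iff by blast
    then have "(i + 1) mod int (length c) = (j + 1) mod int (length c)"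
      by (metis mod_add_left_eq)
    then show ?thesis using 1 cyc_nth_cong by metis
  next
    case 2
    then have "i mod int (length c) = (j + 1) mod int (length c)"
      using assms cyc_nth_eq_iff by blast
    then have "(i - 1) mod int (length c) = (j + 1 - 1) mod int (length c)"
      by (metis mod_diff_left_eq)
    then show ?thesis using 2 cyc_nth_cong by (metis add_diff_cancel_right')
  qed
qed

text \<open>A return after two steps would make the length divide 2. The two neighbours of a vertex
  are thus distinct, which gives a cycle a sense of direction.\<close>

lemma cyc_nth_neq_two_apart:
  assumes "distinct c" and "3 \<le> length c"
  shows "cyc_nth c (i + 2) \<noteq> cyc_nth c i"
proof
  assume "cyc_nth c (i + 2) = cyc_nth c i"
  then have "(i + 2) mod int (length c) = i mod int (length c)"
    using assms cyc_nth_eq_iff[of c] by (metis list.size(3) not_numeral_le_zero)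
  then have "int (length c) dvd 2"
    by (metis add_diff_cancel_left' mod_eq_dvd_iff)
  then show False using assms zdvd_imp_le by fastforce
qed

text \<open>The automorphism group of a cycle is dihedral: the images of positions 0 and 1 determine
  \<open>e\<close> and \<open>\<sigma>\<close>, and injectivity forbids turning back later.\<close>

lemma cycle_automorphism:
  assumes c: "distinct c" "3 \<le> length c"
    and g: "inj_on g (set c)" "g ` set c \<subseteq> set c" "image g ` cycle_edges c = cycle_edges c"
  obtains e \<sigma> :: int
  where "\<sigma> = 1 \<or> \<sigma> = -1" and "\<And>i. g (cyc_nth c i) = cyc_nth c (e + \<sigma> * i)"
proof -
  have ne: "c \<noteq> []" using c by auto
  have in_c: "cyc_nth c i \<in> set c" for i using ne cyc_nth_in_set by blast
  have edge: "{g (cyc_nth c i), g (cyc_nth c (i + 1))} \<in> cycle_edges c" for i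
  proof -
    have "g ` {cyc_nth c i, cyc_nth c (i + 1)} \<in> image g ` cycle_edges c"
      using ne cycle_edges_eq_range by blast
    then show ?thesis using g by simp
  qed
  obtain e where e: "g (cyc_nth c 0) = cyc_nth c e"
    using g(2) in_c by (metis cyc_nth_surj image_subset_iff)
  obtain \<sigma> :: int where \<sigma>: "\<sigma> = 1 \<or> \<sigma> = -1" and e1: "g (cyc_nth c 1) = cyc_nth c (e + \<sigma>)"
    using edge[of 0] cyc_nth_neighbour[OF c(1) ne, of e "g (cyc_nth c 1)"] e
    by (metis add_0 diff_conv_add_uminus)
  \<comment> \<open>Two consecutive positions are carried along, because the earlier one rules out
    one of the two neighbours at the next step.\<close>
  have step: "g (cyc_nth c (int k)) = cyc_nth c (e + \<sigma> * int k) \<and>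
      g (cyc_nth c (int k + 1)) = cyc_nth c (e + \<sigma> * (int k + 1))" for k
  proof (induction k)
    case 0
    then show ?case using e e1 by simp
  next
    case (Suc k)
    let ?y = "g (cyc_nth c (int k + 2))"
    have "{cyc_nth c (e + \<sigma> * (int k + 1)), ?y} \<in> cycle_edges c"
      using edge[of "int k + 1"] Suc by (simp add: add.assoc)
    then have "?y = cyc_nth c (e + \<sigma> * (int k + 1) + 1) \<or> ?y = cyc_nth c (e + \<sigma> * (int k + 1) - 1)"
      using cyc_nth_neighbour[OF c(1) ne] by blast
    moreover have "?y \<noteq> cyc_nth c (e + \<sigma> * int k)"
      using Suc g(1) in_c cyc_nth_neq_two_apart[OF c] by (metis inj_on_eq_iff)
    ultimately have "?y = cyc_nth c (e + \<sigma> * (int k + 2))"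
      using \<sigma> by (auto simp: algebra_simps)
    then show ?case using Suc by (simp add: add.assoc add.commute)
  qed
  have "g (cyc_nth c i) = cyc_nth c (e + \<sigma> * i)" for i
  proof -
    let ?k = "nat (i mod int (length c))"
    have k: "int ?k = i mod int (length c)" using ne by simp
    have "cyc_nth c (e + \<sigma> * int ?k) = cyc_nth c (e + \<sigma> * i)"
      unfolding k by (rule cyc_nth_cong) (metis mod_add_right_eq mod_mult_right_eq)
    then show ?thesis using step[of ?k] k cyc_nth_mod by metis
  qed
  with \<sigma> that show thesis by blast
qed

section \<open>Translations of the multipartite graph\<close>

abbreviation translate_edges :: "nat \<Rightarrow> nat \<Rightarrow> int \<Rightarrow> int set set \<Rightarrow> int set set" where
  "translate_edges m n t X \<equiv> image (translate m n t) ` X"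

text \<open>Reduction modulo \<open>m * n\<close> preserves divisibility by \<open>m\<close>, so
  adjacency can be tested on plain integer differences.\<close>

lemma part_subgroup_iff:
  assumes "m \<ge> 1" and "n \<ge> 1"
  shows "z mod int (m * n) \<in> part_subgroup m n \<longleftrightarrow> int m dvd z"
proof -
  let ?N = "int (m * n)"
  have N: "?N > 0" using assms by simp
  have mN: "int m dvd ?N" by simp
  show ?thesis
  proof
    assume "z mod ?N \<in> part_subgroup m n"
    then obtain k where "z mod ?N = int m * k mod ?N"
      by (auto simp: part_subgroup_def)
    then show "int m dvd z"
      using mN by (metis dvd_mod_iff dvd_triv_left)
  next
    assume "int m dvd z"
    then obtain k where k: "z = int m * k" by blast
    have "int m * (k mod ?N) mod ?N = z mod ?N" by (simp add: k mod_simps)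
    moreover have "k mod ?N \<in> multipartite_verts m n"
      using N by (simp add: multipartite_verts_def)
    ultimately show "z mod ?N \<in> part_subgroup m n"
      unfolding part_subgroup_def by force
  qed
qed

lemma multipartite_edges_eq:
  assumes "m \<ge> 1" and "n \<ge> 1"
  shows "multipartite_edges m n =
    {{x, y} | x y. x \<in> multipartite_verts m n \<and> y \<in> multipartite_verts m n \<and> \<not> int m dvd x - y}"
  unfolding multipartite_edges_def using part_subgroup_iff[OF assms] by simp

lemma multipartite_edges_iff:
  assumes "m \<ge> 1" and "n \<ge> 1"
  shows "{x, y} \<in> multipartite_edges m n \<longleftrightarrow>
    x \<in> multipartite_verts m n \<and> y \<in> multipartite_verts m n \<and> \<not> int m dvd x - y"
  unfolding multipartite_edges_eq[OF assms]
  by (auto simp: doubleton_eq_iff dvd_diff_commute)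

lemma hamiltonian_cycle_length:
  assumes "hamiltonian_cycle (multipartite_verts m n) E c"
  shows "length c = m * n"
  using assms distinct_card[of c]
  by (auto simp: hamiltonian_cycle_def multipartite_verts_def simp flip: of_nat_mult)

lemma translate_in_verts: "m * n \<ge> 1 \<Longrightarrow> translate m n t x \<in> multipartite_verts m n"
  by (auto simp: translate_def multipartite_verts_def)

lemma translate_translate: "translate m n s (translate m n t x) = translate m n (s + t) x"
  by (simp add: translate_def mod_simps ac_simps)

lemma translate_eq_iff:
  assumes "x \<in> multipartite_verts m n" "y \<in> multipartite_verts m n"
  shows "translate m n t x = translate m n t y \<longleftrightarrow> x = y"
proof
  assume "translate m n t x = translate m n t y"
  then have "(x + t - t) mod int (m * n) = (y + t - t) mod int (m * n)"
    unfolding translate_def by (metis mod_diff_left_eq)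
  then show "x = y" using assms by (simp add: multipartite_verts_def)
qed simp

lemma inj_on_translate: "inj_on (translate m n t) (multipartite_verts m n)"
  by (simp add: inj_on_def translate_eq_iff)

lemma translate_eq_self_iff:
  assumes "x \<in> multipartite_verts m n"
  shows "translate m n t x = x \<longleftrightarrow> int (m * n) dvd t"
  using assms unfolding translate_def multipartite_verts_def
  by (metis add_diff_cancel_left' atLeastLessThan_iff mod_eq_dvd_iff mod_pos_pos_trivial)

lemma translate_edges_translate_edges:
  "translate_edges m n s (translate_edges m n t X) = translate_edges m n (s + t) X"
  by (simp add: image_image translate_translate)

text \<open>A translation acting on a hamiltonian cycle cannot reverse it: as \<open>n\<close> is even, a reversing
  translation would be by \<open>m * n div 2\<close> and interchange the ends of an edge inside a part.\<close>

lemma translation_rotates: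
  assumes mn: "m \<ge> 1" "n \<ge> 1" "even n"
    and ham: "hamiltonian_cycle (multipartite_verts m n) (multipartite_edges m n) c"
    and fix_c: "translate_edges m n t (cycle_edges c) = cycle_edges c"
  obtains e where "\<And>i. translate m n t (cyc_nth c i) = cyc_nth c (i + e)"
proof -
  let ?N = "int (m * n)" and ?V = "multipartite_verts m n"
  have c: "distinct c" "3 \<le> length c" "set c = ?V" "cycle_edges c \<subseteq> multipartite_edges m n"
    using ham by (auto simp: hamiltonian_cycle_def)
  have len: "int (length c) = ?N" using hamiltonian_cycle_length[OF ham] by simp
  have ne: "c \<noteq> []" using c by auto
  have N: "m * n \<ge> 1" using mn by simp
  have in_V: "cyc_nth c i \<in> ?V" for i using cyc_nth_in_set[OF ne] c by simp
  obtain e \<sigma> :: int where \<sigma>: "\<sigma> = 1 \<or> \<sigma> = -1"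
    and e: "\<And>i. translate m n t (cyc_nth c i) = cyc_nth c (e + \<sigma> * i)"
  proof (rule cycle_automorphism[of c "translate m n t"])
    show "inj_on (translate m n t) (set c)" using c inj_on_translate by simp
    show "translate m n t ` set c \<subseteq> set c" using c N translate_in_verts by blast
  qed (use c fix_c in auto)
  show thesis
  proof (cases "?N dvd t")
    case True
    then have "translate m n t (cyc_nth c i) = cyc_nth c (i + 0)" for i
      using translate_eq_self_iff in_V by simp
    then show thesis using that by blast
  next
    case False
    show thesis
    proof (cases "\<sigma> = 1")
      case True
      then show thesis using that[of e] e by (simp add: add.commute)
    next
      case False
      with \<sigma> have \<sigma>: "\<sigma> = -1" by simp
      \<comment> \<open>A reflection is an involution, so \<open>2 * t\<close> vanishes modulo
        \<open>m * n\<close>; since \<open>n\<close> is even, \<open>m\<close> divides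
        \<open>t\<close>.\<close>
      have "translate m n (t + t) (cyc_nth c 0) = cyc_nth c 0"
        using e[of 0] e[of e] \<sigma> unfolding translate_translate[symmetric] by simp
      then have "?N dvd t + t"
        using translate_eq_self_iff in_V by blast
      then have "2 * (int m * int (n div 2)) dvd 2 * t"
        using \<open>even n\<close> by (metis even_two_times_div_two mult.left_commute mult_2 of_nat_mult of_nat_numeral)
      then have mt: "int m dvd t" by (metis dvd_mult_cancel_left dvd_mult_left zero_neq_numeral)
      \<comment> \<open>For even \<open>e\<close> the reflection fixes a vertex, which a nontrivial
        translation cannot do. For odd \<open>e\<close> it swaps the ends of an edge, whose
        difference would then be a multiple of \<open>m\<close>.\<close>
      show thesis
      proof (cases "even e")
        case True
        then obtain i where "e = i + i" by (metis evenE mult_2)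
        then have "translate m n t (cyc_nth c i) = cyc_nth c i"
          using e[of i] \<sigma> by simp
        then have "?N dvd t"
          using translate_eq_self_iff in_V by blast
        with \<open>\<not> ?N dvd t\<close> show thesis by simp
      next
        case False
        then obtain i where "e = 2 * i + 1" by (elim oddE)
        then have i: "translate m n t (cyc_nth c i) = cyc_nth c (i + 1)"
          using e[of i] \<sigma> by (simp add: algebra_simps)
        have "{cyc_nth c i, cyc_nth c (i + 1)} \<in> multipartite_edges m n"
          using c(4) cycle_edges_eq_range[OF ne] by blast
        then have "\<not> int m dvd cyc_nth c i - (cyc_nth c i + t) mod ?N"
          using multipartite_edges_iff[OF mn(1,2)] i by (simp add: translate_def)
        moreover have "int m dvd cyc_nth c i - (cyc_nth c i + t) mod ?N"
        proof -
          have "int m dvd ?N" by simp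
          moreover have "?N dvd (cyc_nth c i + t) - (cyc_nth c i + t) mod ?N"
            by (simp add: dvd_minus_mod)
          ultimately have "int m dvd (cyc_nth c i + t) - (cyc_nth c i + t) mod ?N - t"
            using mt by (meson dvd_diff dvd_trans)
          then show ?thesis by (simp add: algebra_simps)
        qed
        ultimately show thesis by simp
      qed
    qed
  qed
qed

section \<open>Odd edges of a periodic cycle\<close>

text \<open>For two distinct ends the sum is symmetric and has the parity of their difference, so no
  orientation of the edge is needed.\<close>

definition odd_edges :: "int set set \<Rightarrow> int set set" where
  "odd_edges X = {a \<in> X. odd (\<Sum>a)}"

lemma card_filter_periodic:
  fixes P :: "nat \<Rightarrow> bool"
  assumes "\<And>i. P (i + d) \<longleftrightarrow> P i"
  shows "card {i \<in> {..<r * d}. P i} = r * card {i \<in> {..<d}. P i}"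
proof (induction r)
  case (Suc r)
  have P: "P (i + r * d) \<longleftrightarrow> P i" for i
  proof (induction r)
    case (Suc r)
    then show ?case using assms[of "i + r * d"] by (simp add: ac_simps)
  qed simp
  have "{i \<in> {..<Suc r * d}. P i} = {i \<in> {..<r * d}. P i} \<union> (\<lambda>i. i + r * d) ` {i \<in> {..<d}. P i}"
  proof (intro equalityI subsetI)
    fix i assume i: "i \<in> {i \<in> {..<Suc r * d}. P i}"
    show "i \<in> {i \<in> {..<r * d}. P i} \<union> (\<lambda>i. i + r * d) ` {i \<in> {..<d}. P i}"
    proof (cases "i < r * d")
      case False
      then have "i - r * d \<in> {i \<in> {..<d}. P i}" using i P[of "i - r * d"] by auto
      then show ?thesis using False by (intro UnI2 image_eqI[of _ _ "i - r * d"]) auto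
    qed (use i in auto)
  qed (use P in auto)
  moreover have "card ((\<lambda>i. i + r * d) ` {i \<in> {..<d}. P i}) = card {i \<in> {..<d}. P i}"
    by (rule card_image) (simp add: inj_on_def)
  moreover have "{i \<in> {..<r * d}. P i} \<inter> (\<lambda>i. i + r * d) ` {i \<in> {..<d}. P i} = {}"
    by auto
  ultimately show ?case
    using Suc by (simp add: card_Un_disjoint)
qed simp

text \<open>Every odd step flips the parity of \<open>a\<close>, so the number of flips has the
  parity of the total change.\<close>

lemma even_card_odd_steps:
  fixes a :: "nat \<Rightarrow> int"
  shows "even (int (card {i \<in> {..<d}. odd (a i + a (Suc i))}) - (a d - a 0))"
proof (induction d)
  case (Suc d)
  have "{i \<in> {..<Suc d}. odd (a i + a (Suc i))} =
    (if odd (a d + a (Suc d)) then insert d else id) {i \<in> {..<d}. odd (a i + a (Suc i))}"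
    by (auto simp: less_Suc_eq)
  then show ?case using Suc by auto
qed simp

lemma cycle_edge_inj:
  assumes "distinct c" and "3 \<le> length c"
  shows "inj_on (\<lambda>i. {cyc_nth c (int i), cyc_nth c (int i + 1)}) {..<length c}"
proof (rule inj_onI)
  fix i j assume ij: "i \<in> {..<length c}" "j \<in> {..<length c}"
    and eq: "{cyc_nth c (int i), cyc_nth c (int i + 1)} = {cyc_nth c (int j), cyc_nth c (int j + 1)}"
  have ne: "c \<noteq> []" using assms by auto
  consider "cyc_nth c (int i) = cyc_nth c (int j)"
    | "cyc_nth c (int i) = cyc_nth c (int j + 1)" "cyc_nth c (int i + 1) = cyc_nth c (int j)"
    using eq by (auto simp: doubleton_eq_iff)
  then show "i = j"
  proof cases
    case 1
    then show ?thesis using ij assms(1) by (simp add: cyc_nth_of_nat nth_eq_iff_index_eq)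
  next
    case 2
    then have "(int i + 1) mod int (length c) = (int j + 1 + 1) mod int (length c)"
      using cyc_nth_eq_iff[OF assms(1) ne] by (metis mod_add_left_eq)
    then have "cyc_nth c (int j + 2) = cyc_nth c (int j)"
      using 2 cyc_nth_cong by (metis add.assoc one_add_one)
    then show ?thesis using cyc_nth_neq_two_apart[OF assms] by blast
  qed
qed

lemma odd_mod_iff: "even (N :: int) \<Longrightarrow> odd (x mod N) \<longleftrightarrow> odd x"
  by (simp add: dvd_mod_iff)

text \<open>Along one period the parity of the vertex changes as often as there are odd edges, and the
  translation realising one period is by an odd multiple of \<open>d\<close> when \<open>d\<close> is odd.\<close>

lemma card_odd_edges:
  assumes mn: "m \<ge> 1" "n \<ge> 1" "even n"
    and ham: "hamiltonian_cycle (multipartite_verts m n) (multipartite_edges m n) c"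
    and d: "d \<ge> 1" "m * n = r * d" "even r"
    and fix_c: "translate_edges m n (int d) (cycle_edges c) = cycle_edges c"
  obtains s where "card (odd_edges (cycle_edges c)) = r * s" and "even (s + d)"
proof -
  let ?N = "int (m * n)" and ?V = "multipartite_verts m n"
  have c: "distinct c" "3 \<le> length c" "set c = ?V"
    using ham by (auto simp: hamiltonian_cycle_def)
  have len: "length c = m * n" using hamiltonian_cycle_length[OF ham] by simp
  have ne: "c \<noteq> []" using c by auto
  have N: "?N = int r * int d" "r \<ge> 1" "?N > 0"
    using d mn by (auto simp flip: of_nat_mult intro!: Suc_leI Nat.gr0I)
  have in_V: "cyc_nth c i \<in> ?V" for i using cyc_nth_in_set[OF ne] c by simp
  have nth_eq: "cyc_nth c i = cyc_nth c j \<longleftrightarrow> ?N dvd i - j" for i j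
    using cyc_nth_eq_iff[OF c(1) ne] len by (simp add: mod_eq_dvd_iff)
  obtain e where e: "\<And>i. translate m n (int d) (cyc_nth c i) = cyc_nth c (i + e)"
    using translation_rotates[OF mn ham fix_c] by blast
  have ke: "translate m n (int k * int d) (cyc_nth c i) = cyc_nth c (i + int k * e)" for k i
  proof (induction k)
    case 0
    then show ?case using translate_eq_self_iff in_V by simp
  next
    case (Suc k)
    have "translate m n (int (Suc k) * int d) (cyc_nth c i) =
        translate m n (int d) (translate m n (int k * int d) (cyc_nth c i))"
      by (simp add: translate_translate algebra_simps)
    also have "\<dots> = cyc_nth c (i + int k * e + e)" by (simp add: Suc e)
    finally show ?case by (simp add: algebra_simps)
  qed
  \<comment> \<open>Translation by \<open>d\<close> and rotation by \<open>e\<close> have the same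
    order. This yields first that \<open>d\<close> divides \<open>e\<close>, then that
    \<open>e'\<close> and \<open>r\<close> are coprime.\<close>
  have period: "?N dvd int k * int d \<longleftrightarrow> ?N dvd int k * e" for k
    using ke[of k 0] nth_eq[of "int k * e" 0] translate_eq_self_iff[OF in_V[of 0], of "int k * int d"] by auto
  have "int r * int d dvd int r * e" using period[of r] N by simp
  then obtain e' where e': "e = int d * e'" using N by (auto elim: dvdE)
  have "coprime e' (int r)"
  proof -
    \<comment> \<open>If \<open>g\<close> exceeded 1, \<open>r / g\<close> times \<open>e\<close>
      would vanish modulo \<open>m * n\<close> although \<open>r / g\<close> times \<open>d\<close>
      does not.\<close>
    define g where "g = gcd e' (int r)"
    have g: "g > 0" "g dvd e'" "g dvd int r" using N by (auto simp: g_def)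
    then obtain k e'' where k: "int r = g * int k" and e'': "e' = g * e''"
      by (metis N(2) dvdE less_le_not_le nonneg_int_cases of_nat_0_le_iff zero_le_mult_iff
          dvd_def linorder_not_less)
    have "int k * e = ?N * e''" using k e' e'' N by simp
    then have "?N dvd int k * int d" using period by simp
    then have "int r dvd int k" using N d(1) by simp
    then have "g dvd 1" using k N g by (auto simp: zdvd_mult_cancel1)
    then show ?thesis using g by (simp add: g_def coprime_iff_gcd_eq_1)
  qed
  then obtain w0 y where w0: "w0 * e' + y * int r = 1"
    by (metis bezout_int coprime_iff_gcd_eq_1)
  \<comment> \<open>\<open>w\<close> inverts \<open>e'\<close> modulo \<open>r\<close>, so
    \<open>w\<close> rotations by \<open>e\<close> advance exactly \<open>d\<close> positions; it is
    odd because \<open>r\<close> is even.\<close>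
  define w where "w = nat (w0 mod int r)"
  have w: "int r dvd int w * e' - 1"
  proof -
    have "int w mod int r = w0 mod int r" using N by (simp add: w_def)
    then have "(int w * e') mod int r = (w0 * e') mod int r" by (metis mod_mult_left_eq)
    also have "w0 * e' = 1 - y * int r" using w0 by simp
    also have "(1 - y * int r) mod int r = 1 mod int r" by (metis mod_diff_right_eq mod_mult_self2_is_0 diff_zero)
    finally show ?thesis by (simp add: mod_eq_dvd_iff)
  qed
  have odd_w: "odd w"
  proof
    assume "even w"
    then have "even (int w * e')" by simp
    moreover have "even (int w * e' - 1)" using w d(3) by (meson dvd_trans even_of_nat)
    ultimately show False by simp
  qed
  have shift: "cyc_nth c (i + int d) = translate m n (int w * int d) (cyc_nth c i)" for i
  proof -
    have "?N dvd (i + int w * e) - (i + int d)"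
    proof -
      have "(i + int w * e) - (i + int d) = (int w * e' - 1) * int d"
        by (simp add: e' algebra_simps)
      then show ?thesis using w N by simp
    qed
    then show ?thesis using ke[of w i] nth_eq by metis
  qed
  have evenN: "even ?N" using N d(3) by simp
  have par: "odd (cyc_nth c (i + int d)) \<longleftrightarrow> odd (cyc_nth c i + int w * int d)" for i
    unfolding shift translate_def using odd_mod_iff[OF evenN] by simp
  define a where "a i = cyc_nth c (int i)" for i
  define s where "s = card {i \<in> {..<d}. odd (a i + a (Suc i))}"
  have "even (a d - a 0 + int d)"
    using par[of 0] odd_w by (auto simp: a_def)
  moreover have "even (int s - (a d - a 0))"
    unfolding s_def by (rule even_card_odd_steps)
  ultimately have "even (s + d)" by (metis dvd_add_right_iff diff_add_cancel even_add even_diff even_of_nat)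
  moreover have "card (odd_edges (cycle_edges c)) = r * s"
  proof -
    let ?f = "\<lambda>i. {cyc_nth c (int i), cyc_nth c (int i + 1)}"
    have sum: "\<Sum>(?f i) = a i + a (Suc i)" for i
    proof -
      have "cyc_nth c (int i) \<noteq> cyc_nth c (int i + 1)"
      proof
        assume "cyc_nth c (int i) = cyc_nth c (int i + 1)"
        then have "?N dvd 1" using nth_eq[of "int i + 1" "int i"] by simp
        then show False using c len by (simp add: zdvd1_eq flip: of_nat_mult)
      qed
      then show ?thesis by (simp add: a_def add.commute)
    qed
    have "odd_edges (cycle_edges c) = ?f ` {i \<in> {..<m * n}. odd (a i + a (Suc i))}"
      unfolding odd_edges_def cycle_edges_eq_image len using sum by auto
    moreover have "inj_on ?f {i \<in> {..<m * n}. odd (a i + a (Suc i))}"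
      using cycle_edge_inj[OF c(1,2)] len by (auto intro: inj_on_subset)
    ultimately have "card (odd_edges (cycle_edges c)) = card {i \<in> {..<r * d}. odd (a i + a (Suc i))}"
      using d by (simp add: card_image)
    also have "\<dots> = r * s"
      unfolding s_def
    proof (rule card_filter_periodic)
      \<comment> \<open>Shifting by a period adds \<open>w * d\<close> to both ends, up to multiples
        of the even \<open>m * n\<close>, and so keeps the parity of their sum.\<close>
      fix i
      have "odd (a (i + d)) \<longleftrightarrow> odd (a i + int w * int d)"
        "odd (a (Suc (i + d))) \<longleftrightarrow> odd (a (Suc i) + int w * int d)"
        using par[of "int i"] par[of "int i + 1"] by (simp_all add: a_def algebra_simps)
      then show "odd (a (i + d) + a (Suc (i + d))) \<longleftrightarrow> odd (a i + a (Suc i))" by auto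
    qed
    finally show ?thesis .
  qed
  ultimately show thesis using that by blast
qed

section \<open>Necessity\<close>

lemma multipartite_hcsD:
  assumes "multipartite_hcs m n \<H>" and "X \<in> \<H>"
  obtains c where "hamiltonian_cycle (multipartite_verts m n) (multipartite_edges m n) c"
    and "X = cycle_edges c"
  using assms unfolding multipartite_hcs_def hamiltonian_cycle_system_def by blast

lemma finite_multipartite_edges: "finite (multipartite_edges m n)"
proof (rule finite_subset)
  show "multipartite_edges m n \<subseteq> Pow (multipartite_verts m n)"
    by (auto simp: multipartite_edges_def)
qed (simp add: multipartite_verts_def)

lemma multipartite_hcs_finite:
  assumes "multipartite_hcs m n \<H>"
  shows "finite \<H>"
  using assms finite_multipartite_edges finite_elements
  unfolding multipartite_hcs_def hamiltonian_cycle_system_def by blast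

section \<open>Counting edges over a cycle system\<close>

lemma card_filter_partition_on:
  assumes "finite E" and "partition_on E \<H>"
  shows "card {a \<in> E. P a} = (\<Sum>X\<in>\<H>. card {a \<in> X. P a})"
proof -
  have "card {a \<in> E. P a} = (\<Sum>a\<in>E. if P a then 1 else 0)"
    using assms(1) by (simp flip: sum.inter_filter)
  also have "\<dots> = (\<Sum>X\<in>\<H>. \<Sum>a\<in>X. if P a then 1 else 0)"
    using assms by (rule sum.partition)
  also have "\<dots> = (\<Sum>X\<in>\<H>. card {a \<in> X. P a})"
  proof (rule sum.cong)
    fix X assume "X \<in> \<H>"
    then have "finite X" using assms by (metis Union_upper finite_subset partition_onD1)
    then show "(\<Sum>a\<in>X. if P a then 1 else 0) = card {a \<in> X. P a}"
      by (simp flip: sum.inter_filter)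
  qed simp
  finally show ?thesis .
qed

lemma card_cycle_edges_at:
  assumes "distinct c" and "3 \<le> length c" and "x \<in> set c"
  shows "card {a \<in> cycle_edges c. x \<in> a} = 2"
proof -
  have ne: "c \<noteq> []" using assms by auto
  obtain k where "x = cyc_nth c (int k)" using assms(3) cyc_nth_surj by metis
  then obtain i where i: "x = cyc_nth c i" by blast
  let ?a = "{x, cyc_nth c (i + 1)}" and ?b = "{x, cyc_nth c (i - 1)}"
  have "{a \<in> cycle_edges c. x \<in> a} = {?a, ?b}"
  proof (intro equalityI subsetI)
    fix a assume a: "a \<in> {a \<in> cycle_edges c. x \<in> a}"
    then obtain y where "a = {x, y}" using cycle_edges_eq_range[OF ne] by fastforce
    then show "a \<in> {?a, ?b}" using a i cyc_nth_neighbour[OF assms(1) ne, of i y] by auto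
  next
    have "?a \<in> cycle_edges c" using cycle_edges_eq_range[OF ne] i by blast
    moreover have "?b = {cyc_nth c (i - 1), cyc_nth c (i - 1 + 1)}" using i by auto
    then have "?b \<in> cycle_edges c" using cycle_edges_eq_range[OF ne] by blast
    ultimately show "a \<in> {a \<in> cycle_edges c. x \<in> a}" if "a \<in> {?a, ?b}" for a using that by auto
  qed
  moreover have "?a \<noteq> ?b"
    using cyc_nth_neq_two_apart[OF assms(1,2), of "i - 1"]
    by (auto simp: doubleton_eq_iff algebra_simps)
  ultimately show ?thesis by simp
qed

text \<open>Serves with \<open>h = n\<close> for the degree of a vertex and with
  \<open>h = n div 2\<close> for the differences up to sign.\<close>

lemma card_nonmultiples_below:
  assumes "m \<ge> 1"
  shows "card {x \<in> {0..<int (m * h)}. \<not> int m dvd x} = (m - 1) * h"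
proof -
  have "{x \<in> {0..<int (m * h)}. int m dvd x} = (\<lambda>k. int m * k) ` {0..<int h}"
    using assms by (auto elim!: dvdE simp: zero_le_mult_iff)
  moreover have "inj_on (\<lambda>k. int m * k) {0..<int h}" using assms by (simp add: inj_on_def)
  ultimately have "card {x \<in> {0..<int (m * h)}. int m dvd x} = h"
    by (simp add: card_image)
  moreover have "{x \<in> {0..<int (m * h)}. \<not> int m dvd x} =
      {0..<int (m * h)} - {x \<in> {0..<int (m * h)}. int m dvd x}" by auto
  moreover have "card ({0..<int (m * h)} - {x \<in> {0..<int (m * h)}. int m dvd x}) =
      card {0..<int (m * h)} - card {x \<in> {0..<int (m * h)}. int m dvd x}"
    by (rule card_Diff_subset) (auto intro: finite_subset[of _ "{0..<int (m * h)}"])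
  ultimately show ?thesis
    by (simp add: diff_mult_distrib nat_mult_distrib)
qed

text \<open>The edges at the vertex 0 are counted in two ways: each cycle contributes two, and the
  degree is \<open>(m - 1) * n\<close>.\<close>

lemma card_multipartite_hcs:
  assumes mn: "m \<ge> 1" "n \<ge> 1" and H: "multipartite_hcs m n \<H>"
  shows "2 * card \<H> = (m - 1) * n"
proof -
  let ?V = "multipartite_verts m n" and ?E = "multipartite_edges m n"
  have 0: "0 \<in> ?V" using mn by (simp add: multipartite_verts_def)
  have part: "partition_on ?E \<H>"
    using H by (simp add: multipartite_hcs_def hamiltonian_cycle_system_def)
  have "{a \<in> ?E. 0 \<in> a} = (\<lambda>y. {0, y}) ` {y \<in> ?V. \<not> int m dvd y}"
  proof (intro equalityI subsetI)
    fix a assume a: "a \<in> {a \<in> ?E. 0 \<in> a}"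
    then obtain y where y: "a = {0, y}" by (auto simp: multipartite_edges_def)
    then show "a \<in> (\<lambda>y. {0, y}) ` {y \<in> ?V. \<not> int m dvd y}"
      using a multipartite_edges_iff[OF mn, of 0 y] by auto
  qed (use 0 multipartite_edges_iff[OF mn, of 0] in auto)
  moreover have "inj_on (\<lambda>y. {0, y}) {y \<in> ?V. \<not> int m dvd y}"
    by (auto simp: inj_on_def doubleton_eq_iff)
  ultimately have "card {a \<in> ?E. 0 \<in> a} = (m - 1) * n"
    using card_nonmultiples_below[OF mn(1), of n] by (simp add: card_image multipartite_verts_def)
  moreover have "card {a \<in> X. 0 \<in> a} = 2" if "X \<in> \<H>" for X
    using multipartite_hcsD[OF H that] card_cycle_edges_at[of _ 0] 0
    by (metis hamiltonian_cycle_def)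
  then have "card {a \<in> ?E. 0 \<in> a} = 2 * card \<H>"
    using card_filter_partition_on[OF finite_multipartite_edges part, of "\<lambda>a. 0 \<in> a"] by simp
  ultimately show ?thesis by simp
qed

text \<open>As \<open>m\<close> is even, an odd difference is never a multiple of \<open>m\<close>;
  the odd edges therefore form the complete bipartite graph between even and odd vertices.\<close>

lemma card_odd_edges_multipartite:
  assumes mn: "m \<ge> 1" "n \<ge> 1" "even m"
  shows "card (odd_edges (multipartite_edges m n)) = (m * n div 2) * (m * n div 2)"
proof -
  let ?V = "multipartite_verts m n" and ?E = "multipartite_edges m n"
  define h where "h = m * n div 2"
  have h: "m * n = 2 * h" using mn by (simp add: h_def)
  have hi: "int m * int n = 2 * int h" using h by (simp flip: of_nat_mult)
  let ?A = "(\<lambda>k. 2 * k) ` {0..<int h}" and ?B = "(\<lambda>k. 2 * k + 1) ` {0..<int h}"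
  have A: "?A = {x \<in> ?V. even x}"
  proof (intro equalityI subsetI)
    fix x assume "x \<in> {x \<in> ?V. even x}"
    then show "x \<in> ?A"
      by (intro image_eqI[of _ _ "x div 2"]) (auto simp: multipartite_verts_def hi)
  qed (auto simp: multipartite_verts_def hi)
  have B: "?B = {x \<in> ?V. odd x}"
  proof (intro equalityI subsetI)
    fix x assume "x \<in> {x \<in> ?V. odd x}"
    then show "x \<in> ?B"
      by (intro image_eqI[of _ _ "x div 2"]) (auto simp: multipartite_verts_def hi)
  qed (auto simp: multipartite_verts_def hi)
  have "odd_edges ?E = (\<lambda>(x, y). {x, y}) ` (?A \<times> ?B)"
  proof (intro equalityI subsetI)
    fix a assume a: "a \<in> odd_edges ?E"
    then obtain x y where xy: "a = {x, y}" by (auto simp: multipartite_edges_def odd_edges_def)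
    then have V: "x \<in> ?V" "y \<in> ?V" "\<not> int m dvd x - y"
      using a multipartite_edges_iff[OF mn(1,2)] by (auto simp: odd_edges_def)
    then have "x \<noteq> y" by auto
    then have "odd (x + y)" using a xy by (simp add: odd_edges_def)
    then consider "x \<in> ?A" "y \<in> ?B" | "y \<in> ?A" "x \<in> ?B" unfolding A B using V by auto
    then show "a \<in> (\<lambda>(x, y). {x, y}) ` (?A \<times> ?B)"
    proof cases
      case 1
      then show ?thesis unfolding xy by (intro image_eqI[of _ _ "(x, y)"]) simp_all
    next
      case 2
      then show ?thesis unfolding xy by (intro image_eqI[of _ _ "(y, x)"]) (simp_all add: insert_commute)
    qed
  next
    fix a assume "a \<in> (\<lambda>(x, y). {x, y}) ` (?A \<times> ?B)"
    then obtain x y where xy: "a = {x, y}" "x \<in> ?V" "even x" "y \<in> ?V" "odd y"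
      unfolding A B by auto
    then have "x \<noteq> y" "odd (x - y)" by auto
    then have "\<not> int m dvd x - y" using mn(3) by (meson dvd_trans even_of_nat)
    then show "a \<in> odd_edges ?E"
      using xy \<open>x \<noteq> y\<close> multipartite_edges_iff[OF mn(1,2)] by (simp add: odd_edges_def)
  qed
  moreover have "inj_on (\<lambda>(x, y). {x, y}) (?A \<times> ?B)"
  proof (rule inj_onI, clarify)
    fix i j i' j' :: int
    assume "{2 * i, 2 * j + 1} = {2 * i', 2 * j' + 1}"
    then show "2 * i = 2 * i' \<and> 2 * j + 1 = 2 * j' + 1"
      by (metis doubleton_eq_iff even_mult_iff even_plus_one_iff dvd_triv_left)
  qed
  moreover have "card ?A = h" "card ?B = h" by (simp_all add: card_image inj_on_def)
  ultimately show ?thesis by (simp add: card_image h_def)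
qed

text \<open>Before reduction by the even modulus both ends gain \<open>t\<close>, so their sum
  changes by \<open>2 * t\<close>.\<close>

lemma card_odd_edges_translate:
  assumes "even m" and X: "X \<subseteq> multipartite_edges m n" and mn: "m \<ge> 1" "n \<ge> 1"
  shows "card (odd_edges (translate_edges m n t X)) = card (odd_edges X)"
proof -
  let ?V = "multipartite_verts m n"
  have par: "odd (\<Sum>(translate m n t ` a)) \<longleftrightarrow> odd (\<Sum>a)" if "a \<in> X" for a
  proof -
    obtain x y where xy: "a = {x, y}" using \<open>a \<in> X\<close> X unfolding multipartite_edges_def by blast
    then have V: "x \<in> ?V" "y \<in> ?V" "x \<noteq> y"
      using that X multipartite_edges_iff[OF mn, of x y] by auto
    then have "translate m n t x \<noteq> translate m n t y" by (simp add: translate_eq_iff)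
    moreover have "even (int (m * n))" using \<open>even m\<close> by simp
    then have "odd (translate m n t z) \<longleftrightarrow> odd (z + t)" for z
      unfolding translate_def by (rule odd_mod_iff)
    ultimately show ?thesis using V by (auto simp: xy)
  qed
  then have "odd_edges (translate_edges m n t X) = image (translate m n t) ` odd_edges X"
    by (auto simp: odd_edges_def)
  moreover have "inj_on (image (translate m n t)) (odd_edges X)"
  proof (rule inj_on_subset)
    show "inj_on (image (translate m n t)) (Pow ?V)"
      using inj_on_translate by (rule inj_on_image_Pow)
    show "odd_edges X \<subseteq> Pow ?V"
      using X by (auto simp: odd_edges_def multipartite_edges_def)
  qed
  ultimately show ?thesis by (simp add: card_image)
qed

text \<open>In an orbit of length \<open>d\<close> every cycle has period \<open>d\<close>, so the odd edges of the orbit number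
  \<open>m * n\<close> times a quantity of the parity of \<open>d\<close>.\<close>

lemma card_cyclic_symmetric_hcs_parity:
  assumes mn: "m \<ge> 1" "n \<ge> 1" "even m" "even n"
    and cyc: "cyclic_hcs m n \<H>" and sym: "phi_symmetric_hcs m n \<H>"
  shows "even (m * n div 4 + card \<H>)"
proof -
  let ?N = "int (m * n)" and ?V = "multipartite_verts m n" and ?E = "multipartite_edges m n"
  let ?\<tau> = "translate_edges m n"
  \<comment> \<open>The correction by \<open>m * n\<close> per cycle turns the parity statement for
    an orbit into divisibility by \<open>2 * m * n\<close>, which can be added up over all
    orbits.\<close>
  define f where "f X = int (card (odd_edges X)) - ?N" for X
  have H: "multipartite_hcs m n \<H>" using cyc by (simp add: cyclic_hcs_def)
  have part: "partition_on ?E \<H>"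
    using H by (simp add: multipartite_hcs_def hamiltonian_cycle_system_def)
  have XE: "X \<subseteq> ?E" if "X \<in> \<H>" for X using part that by (auto simp: partition_on_def)
  have EV: "?E \<subseteq> Pow ?V" by (auto simp: multipartite_edges_def)
  have closed1: "?\<tau> 1 X \<in> \<H>" and phi: "?\<tau> (int m) X = X" if X: "X \<in> \<H>" for X
  proof -
    obtain c where "hamiltonian_cycle ?V ?E c" "X = cycle_edges c"
      using multipartite_hcsD[OF H X] .
    then show "?\<tau> 1 X \<in> \<H>" "?\<tau> (int m) X = X"
      using cyc sym X by (auto simp: cyclic_hcs_def phi_symmetric_hcs_def cycle_edges_map phi_def)
  qed
  have \<tau>0: "?\<tau> 0 X = X" if "X \<in> \<H>" for X
  proof -
    have "translate m n 0 ` a = a" if "a \<in> X" for a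
    proof -
      have "a \<subseteq> ?V" using that XE[OF \<open>X \<in> \<H>\<close>] EV by blast
      then have "translate m n 0 x = x" if "x \<in> a" for x using that translate_eq_self_iff by auto
      then show ?thesis by auto
    qed
    then show ?thesis by auto
  qed
  have closed_nat: "?\<tau> (int k) X \<in> \<H>" if "X \<in> \<H>" for k X
  proof (induction k)
    case (Suc k)
    have "?\<tau> (int (Suc k)) X = ?\<tau> 1 (?\<tau> (int k) X)"
      unfolding translate_edges_translate_edges by simp
    then show ?case using closed1[OF Suc] by simp
  qed (use \<tau>0 that in simp)
  \<comment> \<open>Negative translations agree with nonnegative ones modulo \<open>m * n\<close>,
    so closure under the unit translation gives the whole group action.\<close>
  have closed: "?\<tau> t X \<in> \<H>" if "X \<in> \<H>" for t X
  proof -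
    have "translate m n t = translate m n (int (nat (t mod ?N)))"
      using mn by (auto simp: translate_def fun_eq_iff mod_simps)
    then show ?thesis using closed_nat[OF that, of "nat (t mod ?N)"] by (simp only:)
  qed
  define R where "R = {(X, Y). X \<in> \<H> \<and> (\<exists>t. Y = ?\<tau> t X)}"
  have R: "equiv \<H> R"
  proof (rule equivI)
    show "R \<subseteq> \<H> \<times> \<H>" using closed by (auto simp: R_def)
    show "refl_on \<H> R"
      unfolding refl_on_def R_def using \<tau>0 by (metis (mono_tags, lifting) case_prodI mem_Collect_eq)
    show "sym R"
    proof (rule symI)
      fix X Y assume "(X, Y) \<in> R"
      then obtain t where t: "X \<in> \<H>" "Y = ?\<tau> t X" by (auto simp: R_def)
      then have "X = ?\<tau> (- t) Y" unfolding t(2) translate_edges_translate_edges using \<tau>0 by simp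
      moreover have "Y \<in> \<H>" using closed t by simp
      ultimately show "(Y, X) \<in> R" unfolding R_def by (intro CollectI case_prodI conjI exI)
    qed
    show "trans R"
    proof (rule transI)
      fix X Y Z assume "(X, Y) \<in> R" "(Y, Z) \<in> R"
      then obtain s t where "X \<in> \<H>" "Z = ?\<tau> s (?\<tau> t X)" by (auto simp: R_def)
      then show "(X, Z) \<in> R"
        unfolding R_def translate_edges_translate_edges by (intro CollectI case_prodI conjI exI)
    qed
  qed
  have orbit: "2 * ?N dvd (\<Sum>Y\<in>R `` {X}. f Y)" if X: "X \<in> \<H>" for X
  proof -
    \<comment> \<open>\<open>d\<close> is the length of the orbit of \<open>X\<close>; a period
      exists because translation by \<open>m\<close> fixes \<open>X\<close>.\<close>
    define d where "d = (LEAST d. d > 0 \<and> ?\<tau> (int d) X = X)"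
    have ex: "m > 0 \<and> ?\<tau> (int m) X = X" using mn phi[OF X] by simp
    have d: "d > 0" "?\<tau> (int d) X = X"
      using LeastI[of "\<lambda>d. d > 0 \<and> ?\<tau> (int d) X = X", OF ex] by (auto simp: d_def)
    have least: "d \<le> k" if "k > 0" "?\<tau> (int k) X = X" for k
      unfolding d_def using that by (intro Least_le) simp
    have mult: "?\<tau> (int d * int k) X = X" for k
    proof (induction k)
      case (Suc k)
      have "?\<tau> (int d * int (Suc k)) X = ?\<tau> (int d) (?\<tau> (int d * int k) X)"
        unfolding translate_edges_translate_edges by (simp add: algebra_simps)
      then show ?case using Suc d by simp
    qed (use \<tau>0 X in simp)
    have mult: "?\<tau> (int d * k) X = X" for k
    proof (cases "k \<ge> 0")
      case True
      then show ?thesis using mult[of "nat k"] by simp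
    next
      case False
      then have "?\<tau> (int d * k) (?\<tau> (int d * int (nat (- k))) X) = X"
        unfolding translate_edges_translate_edges using \<tau>0[OF X] by simp
      then show ?thesis by (simp only: mult)
    qed
    have mod: "?\<tau> t X = ?\<tau> (t mod int d) X" for t
    proof -
      have "?\<tau> t X = ?\<tau> (t mod int d) (?\<tau> (int d * (t div int d)) X)"
        unfolding translate_edges_translate_edges by simp
      then show ?thesis by (simp only: mult)
    qed
    \<comment> \<open>By minimality the remainder \<open>m mod d\<close> cannot be a smaller period.
      Thus \<open>d\<close> divides \<open>m\<close>, and \<open>r\<close> inherits the even factor
      \<open>n\<close>.\<close>
    have "int m mod int d = 0"
    proof (rule ccontr)
      assume *: "int m mod int d \<noteq> 0"
      have "?\<tau> (int (m mod d)) X = X" using mod[of "int m"] phi[OF X] by (simp add: zmod_int)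
      moreover have "m mod d > 0" using * by (metis neq0_conv of_nat_0 zmod_int)
      ultimately have "d \<le> m mod d" using least by blast
      then show False using mod_less_divisor[OF d(1), of m] by linarith
    qed
    then have "d dvd m" by (metis dvd_eq_mod_eq_0 int_dvd_int_iff)
    then obtain r' where r': "m = d * r'" by blast
    define r where "r = r' * n"
    have r: "m * n = r * d" "even r" using mn r' by (auto simp: r_def)
    have orb: "R `` {X} = (\<lambda>t. ?\<tau> (int t) X) ` {..<d}"
    proof (intro equalityI subsetI)
      fix Y assume "Y \<in> R `` {X}"
      then obtain t where "Y = ?\<tau> t X" by (auto simp: R_def)
      then have "Y = ?\<tau> (int (nat (t mod int d))) X" using mod d by simp
      moreover have "nat (t mod int d) < d" using d by (simp add: nat_less_iff)
      ultimately show "Y \<in> (\<lambda>t. ?\<tau> (int t) X) ` {..<d}" by blast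
    qed (use X in \<open>auto simp: R_def\<close>)
    have inj: "inj_on (\<lambda>t. ?\<tau> (int t) X) {..<d}"
    proof (rule linorder_inj_onI)
      fix s t assume st: "s < t" "t \<in> {..<d}"
      show "?\<tau> (int s) X \<noteq> ?\<tau> (int t) X"
      proof
        assume "?\<tau> (int s) X = ?\<tau> (int t) X"
        then have "?\<tau> (- int s) (?\<tau> (int s) X) = ?\<tau> (- int s) (?\<tau> (int t) X)" by simp
        then have "X = ?\<tau> (int (t - s)) X"
          unfolding translate_edges_translate_edges using \<tau>0[OF X] st by (simp add: of_nat_diff)
        then show False using least[of "t - s"] st by auto
      qed
    qed auto
    obtain c where c: "hamiltonian_cycle ?V ?E c" "X = cycle_edges c"
      using multipartite_hcsD[OF H X] .
    obtain s where s: "card (odd_edges X) = r * s" "even (s + d)"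
      using card_odd_edges[OF mn(1,2,4) c(1) _ r, of thesis] d c by auto
    have "f (?\<tau> t X) = int r * int s - ?N" for t
      unfolding f_def using card_odd_edges_translate[OF mn(3) XE[OF X] mn(1,2)] s by simp
    then have "(\<Sum>Y\<in>R `` {X}. f Y) = int d * (int r * int s - ?N)"
      unfolding orb by (simp add: sum.reindex[OF inj])
    also have "\<dots> = ?N * (int s - int d)"
      unfolding r by (simp add: algebra_simps)
    finally have "(\<Sum>Y\<in>R `` {X}. f Y) = ?N * (int s - int d)" .
    moreover have "even (int s - int d)" using s(2) by simp
    ultimately show ?thesis by (auto elim!: evenE)
  qed
  have "(\<Sum>X\<in>\<H>. f X) = (\<Sum>B\<in>\<H> // R. \<Sum>Y\<in>B. f Y)"
    using multipartite_hcs_finite[OF H] partition_on_quotient[OF R] by (rule sum.partition)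
  also have "2 * ?N dvd \<dots>"
    by (rule dvd_sum) (metis orbit quotientE)
  finally have "2 * ?N dvd (\<Sum>X\<in>\<H>. f X)" .
  moreover have "(\<Sum>X\<in>\<H>. f X) = ?N * (int (m * n div 4) - int (card \<H>))"
  proof -
    have "card (odd_edges ?E) = (\<Sum>X\<in>\<H>. card (odd_edges X))"
      unfolding odd_edges_def using finite_multipartite_edges part by (rule card_filter_partition_on)
    moreover have "card (odd_edges ?E) = m * n * (m * n div 4)"
    proof -
      obtain a b where "m = 2 * a" "n = 2 * b" using mn by (auto elim!: evenE)
      then show ?thesis using card_odd_edges_multipartite[OF mn(1-3)] by simp
    qed
    ultimately have "(\<Sum>X\<in>\<H>. int (card (odd_edges X))) = ?N * int (m * n div 4)"
      by (metis of_nat_mult of_nat_sum)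
    then show ?thesis by (simp add: f_def sum_subtractf algebra_simps)
  qed
  ultimately have "?N * 2 dvd ?N * (int (m * n div 4) - int (card \<H>))" by (simp add: mult.commute)
  then have "even (int (m * n div 4) - int (card \<H>))" using mn by simp
  then show ?thesis by (simp flip: of_nat_add)
qed

text \<open>For \<open>m = 4 * a\<close> and \<open>n = 2 * b\<close> with \<open>b\<close> odd, the
  number \<open>(m - 1) * b\<close> of cycles is odd while \<open>m * n div 4 = 2 * (a * b)\<close>
  is even, against the parity result.\<close>

lemma cyclic_symmetric_hcs_necessary:
  assumes mn: "m \<ge> 2" "even m" "n \<ge> 1"
    and cyc: "cyclic_hcs m n \<H>" and sym: "phi_symmetric_hcs m n \<H>"
  shows "even n \<and> (n mod 4 = 2 \<longrightarrow> m mod 4 = 2)"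
proof -
  have "multipartite_hcs m n \<H>" using cyc by (simp add: cyclic_hcs_def)
  then have card: "2 * card \<H> = (m - 1) * n" using card_multipartite_hcs mn by simp
  have "even ((m - 1) * n)" by (metis card dvd_triv_left)
  then have "even n" using mn by simp
  moreover have "m mod 4 = 2" if n: "n mod 4 = 2"
  proof (rule ccontr)
    assume "m mod 4 \<noteq> 2"
    then have "4 dvd m" using mn(2) by presburger
    then obtain a where a: "m = 4 * a" by blast
    obtain b where b: "n = 2 * b" "odd b" 
    proof
      show "n = 2 * (n div 2)" "odd (n div 2)" using n by presburger+
    qed
    have "card \<H> = (m - 1) * b" using card b by simp
    moreover have "m * n div 4 = 2 * (a * b)" using a b by simp
    moreover have "even (m * n div 4 + card \<H>)"
      using card_cyclic_symmetric_hcs_parity mn \<open>even n\<close> cyc sym by simp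
    ultimately have "even ((m - 1) * b)" by simp
    then show False using mn b by simp
  qed
  ultimately show ?thesis by blast
qed

section \<open>Systems generated by base cycles\<close>

text \<open>A base cycle of period \<open>d\<close> is the sequence with \<open>a\<^sub>i = b i\<close> for \<open>i < d\<close> and \<open>a\<^sub>i\<^sub>+\<^sub>d = a\<^sub>i + d * v\<close>.  Its edge set
  after translation by \<open>t\<close> consists of all edges \<open>{x, x + a\<^sub>i\<^sub>+\<^sub>1 - a\<^sub>i}\<close> with \<open>x \<equiv> b i + t\<close> modulo \<open>d\<close>,
  because \<open>v\<close> is prime to \<open>N / d\<close>.\<close>

definition base_step :: "nat \<Rightarrow> int \<Rightarrow> (nat \<Rightarrow> int) \<Rightarrow> nat \<Rightarrow> int" where
  "base_step d v b i = (if Suc i < d then b (Suc i) else b 0 + int d * v) - b i"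

definition base_edges :: "int \<Rightarrow> nat \<Rightarrow> int \<Rightarrow> (nat \<Rightarrow> int) \<Rightarrow> int \<Rightarrow> int set set" where
  "base_edges N d v b t =
    {{x mod N, (x + base_step d v b i) mod N} | x i. i < d \<and> int d dvd x - b i - t}"

text \<open>Within a period each class modulo \<open>d\<close> is met once; successive periods add
  \<open>d * v\<close>, and since \<open>v\<close> is invertible modulo \<open>r\<close> they run
  through the whole class.\<close>

lemma base_edges_hamiltonian:
  assumes d: "d \<ge> 1" and L: "L = r * d" "L \<ge> 3"
    and v: "coprime v (int r)" and b: "inj_on (\<lambda>i. b i mod int d) {..<d}"
  obtains c where "length c = L" "distinct c" "set c = {0..<int L}"
    "cycle_edges c = base_edges (int L) d v b t"
proof -
  let ?N = "int L"
  have N: "?N = int r * int d" using L by simp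
  have r: "r > 0" using L by (auto intro!: Nat.gr0I)
  have N0: "?N > 0" using L by linarith
  define a where "a k = b (k mod d) + int d * v * int (k div d) + t" for k
  define c where "c = map (\<lambda>k. a k mod ?N) [0..<L]"
  have a_Suc: "a (Suc k) = a k + base_step d v b (k mod d)" for k
  proof -
    have "k mod d < d" using d by simp
    then have "Suc (k mod d) < d \<longleftrightarrow> Suc (k mod d) \<noteq> d" by linarith
    then show ?thesis by (auto simp: a_def base_step_def mod_Suc div_Suc algebra_simps)
  qed
  have len: "length c = L" by (simp add: c_def)
  have nth: "c ! k = a k mod ?N" if "k < L" for k using that by (simp add: c_def)
  have nth_Suc: "c ! (Suc k mod L) = a (Suc k) mod ?N" if "k < L" for k
  proof (cases "Suc k = L")
    case True
    \<comment> \<open>The sequence closes up after \<open>r\<close> periods, which together add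
      \<open>r * d * v\<close>, a multiple of the modulus.\<close>
    have "a L = a 0 + ?N * v" using d N by (simp add: a_def L(1))
    then show ?thesis using True nth[of 0] L(2) by simp
  qed (use that nth in simp)
  have "inj_on (\<lambda>k. a k mod ?N) {..<L}"
  proof (rule inj_onI)
    fix k l assume kl: "k \<in> {..<L}" "l \<in> {..<L}" and eq: "a k mod ?N = a l mod ?N"
    have dvd: "?N dvd a k - a l" using eq by (simp add: mod_eq_dvd_iff)
    then have "int d dvd a k - a l" using N by (metis dvd_mult_right)
    moreover have "a k - a l = b (k mod d) - b (l mod d) + int d * (v * int (k div d) - v * int (l div d))"
      by (simp add: a_def algebra_simps)
    ultimately have "int d dvd b (k mod d) - b (l mod d)"
      by (metis dvd_add_left_iff dvd_triv_left)
    then have "b (k mod d) mod int d = b (l mod d) mod int d" by (simp add: mod_eq_dvd_iff)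
    then have m: "k mod d = l mod d" using b d by (auto dest!: inj_onD)
    then have "a k - a l = int d * (v * (int (k div d) - int (l div d)))"
      by (simp add: a_def algebra_simps)
    then have "int r dvd v * (int (k div d) - int (l div d))"
      using dvd N d by (simp add: mult.commute)
    then have "int r dvd int (k div d) - int (l div d)"
      using v by (metis coprime_commute coprime_dvd_mult_right_iff)
    then have "int (k div d) mod int r = int (l div d) mod int r" by (simp add: mod_eq_dvd_iff)
    moreover have "k div d < r" "l div d < r"
      using kl L d by (simp_all add: less_mult_imp_div_less)
    ultimately have "k div d = l div d" by (simp flip: zmod_int)
    then show "k = l" using m by (metis div_mult_mod_eq)
  qed
  then have dist: "distinct c" by (auto simp: c_def distinct_map atLeast0LessThan)
  have "set c = {0..<?N}"
  proof (rule card_subset_eq)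
    show "set c \<subseteq> {0..<?N}" using N0 by (auto simp: c_def simp del: of_nat_mult)
    show "card (set c) = card {0..<?N}" using distinct_card[OF dist] len by simp
  qed simp
  moreover have "cycle_edges c = base_edges ?N d v b t"
  proof (intro equalityI subsetI)
    fix e assume "e \<in> cycle_edges c"
    then obtain k where "k < L" "e = {a k mod ?N, (a k + base_step d v b (k mod d)) mod ?N}"
      using nth nth_Suc by (auto simp: cycle_edges_def len a_Suc)
    moreover have "int d dvd a k - b (k mod d) - t" by (simp add: a_def)
    moreover have "k mod d < d" using d by simp
    ultimately show "e \<in> base_edges ?N d v b t" unfolding base_edges_def by blast
  next
    fix e assume "e \<in> base_edges ?N d v b t"
    then obtain x i where e: "e = {x mod ?N, (x + base_step d v b i) mod ?N}"
      and i: "i < d" and "int d dvd x - b i - t"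
      by (auto simp: base_edges_def)
    then obtain w where "x - b i - t = int d * w" by blast
    then have x: "x = b i + t + int d * w" by simp
    \<comment> \<open>To find \<open>x\<close> on the cycle, the period number \<open>q\<close> must
      satisfy \<open>v * q = w\<close> modulo \<open>r\<close>; the inverse \<open>v'\<close> of
      \<open>v\<close> provides it.\<close>
    obtain v' y where v': "v' * v + y * int r = 1"
      using v by (metis bezout_int coprime_iff_gcd_eq_1)
    define q where "q = nat (v' * w mod int r)"
    have q: "q < r" "int q mod int r = v' * w mod int r" using r by (simp_all add: q_def nat_less_iff)
    define k where "k = q * d + i"
    have k: "k div d = q" "k mod d = i" using i by (simp_all add: k_def)
    have "k < q * d + d" using i by (simp add: k_def)
    also have "\<dots> \<le> L" using q(1) L(1) by (metis Suc_leI add.commute mult_Suc mult_le_mono1)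
    finally have kL: "k < L" .
    have "int r dvd int q - v' * w" using q(2) unfolding mod_eq_dvd_iff .
    then have "int r dvd v * (int q - v' * w)" by simp
    moreover have "int r dvd w - v' * v * w"
    proof -
      have "w - v' * v * w = (1 - v' * v) * w" by (simp add: algebra_simps)
      also have "1 - v' * v = y * int r" using v' by simp
      finally show ?thesis by simp
    qed
    ultimately have "int r dvd v * (int q - v' * w) - (w - v' * v * w)" by (rule dvd_diff)
    then have "int r dvd v * int q - w" by (simp add: algebra_simps)
    moreover have "a k - x = (v * int q - w) * int d" by (simp add: a_def k x algebra_simps)
    ultimately have "?N dvd a k - x" using N by simp
    then have ax: "a k mod ?N = x mod ?N" by (simp add: mod_eq_dvd_iff)
    then have "a (Suc k) mod ?N = (x + base_step d v b i) mod ?N"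
      unfolding a_Suc k by (metis mod_add_left_eq)
    then have "e = {c ! k, c ! (Suc k mod length c)}"
      using e ax nth[OF kL] nth_Suc[OF kL] by (simp only: len)
    then show "e \<in> cycle_edges c" unfolding cycle_edges_def using kL len by blast
  qed
  ultimately show thesis using that len dist by blast
qed

text \<open>A base cycle of period \<open>d\<close> thus has at most \<open>d\<close> translates; if
  \<open>d\<close> divides \<open>m\<close>, each of them is fixed by translation by
  \<open>m\<close>.\<close>

lemma base_edges_cong:
  assumes "int d dvd t - t'"
  shows "base_edges N d v b t = base_edges N d v b t'"
proof -
  have "int d dvd x - b i - t \<longleftrightarrow> int d dvd x - b i - t'" for x i
    using assms dvd_diff[of "int d" "x - b i - t'" "t - t'"] dvd_add[of "int d" "x - b i - t" "t - t'"]
    by (auto simp: algebra_simps)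
  then show ?thesis by (simp add: base_edges_def)
qed

lemma translate_base_edges:
  "translate_edges m n u (base_edges (int (m * n)) d v b t) = base_edges (int (m * n)) d v b (t + u)"
proof -
  let ?N = "int (m * n)" and ?s = "base_step d v b"
  have img: "translate m n u ` {x mod ?N, (x + s) mod ?N} = {(x + u) mod ?N, (x + u + s) mod ?N}" for x s
    by (simp add: translate_def mod_simps algebra_simps)
  have "translate_edges m n u (base_edges ?N d v b t) =
    {{(x + u) mod ?N, (x + u + ?s i) mod ?N} | x i. i < d \<and> int d dvd x - b i - t}"
    unfolding base_edges_def using img by blast
  also have "\<dots> = base_edges ?N d v b (t + u)"
  proof (intro equalityI subsetI)
    fix e assume "e \<in> {{(x + u) mod ?N, (x + u + ?s i) mod ?N} | x i. i < d \<and> int d dvd x - b i - t}"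
    then obtain x i where "e = {(x + u) mod ?N, (x + u + ?s i) mod ?N}" "i < d" "int d dvd x - b i - t"
      by blast
    moreover have "x + u - b i - (t + u) = x - b i - t" by simp
    ultimately show "e \<in> base_edges ?N d v b (t + u)"
      unfolding base_edges_def by (metis (mono_tags, lifting) mem_Collect_eq)
  next
    fix e assume "e \<in> base_edges ?N d v b (t + u)"
    then obtain x i where "e = {x mod ?N, (x + ?s i) mod ?N}" "i < d" "int d dvd x - b i - (t + u)"
      unfolding base_edges_def by blast
    moreover have "x - b i - (t + u) = (x - u) - b i - t" "x = x - u + u" by simp_all
    ultimately show "e \<in> {{(x + u) mod ?N, (x + u + ?s i) mod ?N} | x i. i < d \<and> int d dvd x - b i - t}"
      by (metis (mono_tags, lifting) mem_Collect_eq)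
  qed
  finally show ?thesis .
qed

text \<open>\<open>cover\<close> and \<open>count\<close> together force every difference to occur
  exactly once up to sign. An edge then determines its base cycle and step, and the class of its
  starting end modulo \<open>d j\<close> determines the translate.\<close>

lemma cyclic_symmetric_hcs_from_base_cycles:
  fixes J :: "'j set" and d :: "'j \<Rightarrow> nat" and v :: "'j \<Rightarrow> int" and b :: "'j \<Rightarrow> nat \<Rightarrow> int"
  assumes mn: "m \<ge> 2" "n \<ge> 2" "even n" and "finite J"
    and d: "\<And>j. j \<in> J \<Longrightarrow> d j \<ge> 1 \<and> d j dvd m"
    and v: "\<And>j. j \<in> J \<Longrightarrow> coprime (v j) (int (m * n div d j))"
    and b: "\<And>j. j \<in> J \<Longrightarrow> inj_on (\<lambda>i. b j i mod int (d j)) {..<d j}"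
    and cover: "\<And>x. 0 < x \<Longrightarrow> 2 * x < int (m * n) \<Longrightarrow> \<not> int m dvd x \<Longrightarrow>
      \<exists>j\<in>J. \<exists>i<d j. \<bar>base_step (d j) (v j) (b j) i\<bar> = x"
    and count: "2 * (\<Sum>j\<in>J. d j) = (m - 1) * n"
  shows "\<exists>\<H>. cyclic_hcs m n \<H> \<and> phi_symmetric_hcs m n \<H>"
proof -
  let ?N = "int (m * n)" and ?V = "multipartite_verts m n" and ?E = "multipartite_edges m n"
  define s where "s j = base_step (d j) (v j) (b j)" for j
  define X where "X j = base_edges ?N (d j) (v j) (b j)" for j
  define h where "h = n div 2"
  have h: "n = 2 * h" using mn by (simp add: h_def)
  have N: "?N > 0" "?N = 2 * int (m * h)" using mn by (auto simp: h)
  have dN: "int (d j) dvd ?N" if "j \<in> J" for j using d[OF that] by simp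
  define A where "A = (SIGMA j:J. {..<d j})"
  define B where "B = {x \<in> {0..<int (m * h)}. \<not> int m dvd x}"
  have "finite A" "card A = (m - 1) * h"
    using count \<open>finite J\<close> by (auto simp: A_def h)
  moreover have "card B = (m - 1) * h"
    unfolding B_def using mn by (intro card_nonmultiples_below) simp
  moreover have BA: "B \<subseteq> (\<lambda>(j, i). \<bar>s j i\<bar>) ` A"
  proof
    fix x assume x: "x \<in> B"
    then have "x \<noteq> 0" by (auto simp: B_def)
    then have "0 < x" "2 * x < ?N" "\<not> int m dvd x" using x N by (auto simp: B_def)
    then show "x \<in> (\<lambda>(j, i). \<bar>s j i\<bar>) ` A" using cover by (force simp: A_def s_def)
  qed
  \<comment> \<open>\<open>A\<close> and \<open>B\<close> have equal size, so a map from
    \<open>A\<close> that covers \<open>B\<close> is a bijection onto \<open>B\<close>.\<close>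
  ultimately have sB: "(\<lambda>(j, i). \<bar>s j i\<bar>) ` A = B" and s_inj: "inj_on (\<lambda>(j, i). \<bar>s j i\<bar>) A"
    by (metis card_image_le card_mono card_subset_eq finite_imageI le_antisym,
        metis card_image_le card_mono eq_card_imp_inj_on finite_imageI le_antisym)
  have s: "\<bar>s j i\<bar> < int (m * h)" "\<not> int m dvd s j i" if "j \<in> J" "i < d j" for j i
  proof -
    have "\<bar>s j i\<bar> \<in> B" using sB that by (force simp: A_def)
    then show "\<bar>s j i\<bar> < int (m * h)" "\<not> int m dvd s j i" by (auto simp: B_def)
  qed
  have abs_less: "x = 0" if "?N dvd x" "\<bar>x\<bar> < ?N" for x
    using that zdvd_imp_le[of ?N "\<bar>x\<bar>"] by force
  have s_eq: "j = j' \<and> i = i'"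
    if "j \<in> J" "i < d j" "j' \<in> J" "i' < d j'" "?N dvd s j i - s j' i'" for j i j' i'
  proof -
    have "s j i = s j' i'"
      using abs_less[OF that(5)] s(1)[OF that(1,2)] s(1)[OF that(3,4)] N by linarith
    then show ?thesis using inj_onD[OF s_inj, of "(j, i)" "(j', i')"] that by (simp add: A_def)
  qed
  \<comment> \<open>Opposite steps would have the same absolute value, hence be the same step and
    equal to 0. So no edge arises from two steps in opposite directions.\<close>
  have s_neq: "\<not> ?N dvd s j i + s j' i'" if "j \<in> J" "i < d j" "j' \<in> J" "i' < d j'" for j i j' i'
  proof
    assume "?N dvd s j i + s j' i'"
    then have "s j i = - s j' i'"
      using abs_less[of "s j i + s j' i'"] s(1)[OF that(1,2)] s(1)[OF that(3,4)] N by linarith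
    then have "j = j' \<and> i = i'"
      using inj_onD[OF s_inj, of "(j, i)" "(j', i')"] that by (simp add: A_def)
    then have "s j i = 0" using \<open>s j i = - s j' i'\<close> by simp
    then show False using s(2)[OF that(1,2)] by simp
  qed
  have X_ham: "\<exists>c. length c = m * n \<and> distinct c \<and> set c = ?V \<and> cycle_edges c = X j t"
    if j: "j \<in> J" for j t
  proof -
    have L: "m * n = (m * n div d j) * d j" using d[OF j] by simp
    have "m * n \<ge> 2 * 2" using mn by (intro mult_le_mono) auto
    then have "m * n \<ge> 3" by linarith
    then obtain c where "length c = m * n" "distinct c" "set c = {0..<?N}" "cycle_edges c = X j t"
      using base_edges_hamiltonian[OF _ L _ v[OF j] b[OF j]] d[OF j] unfolding X_def by metis
    then show ?thesis by (auto simp: multipartite_verts_def)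
  qed
  have X_E: "X j t \<subseteq> ?E" if j: "j \<in> J" for j t
  proof
    fix e assume "e \<in> X j t"
    then obtain x i where e: "e = {x mod ?N, (x + s j i) mod ?N}" and i: "i < d j"
      by (auto simp: X_def base_edges_def s_def)
    have "?N dvd (x mod ?N - (x + s j i) mod ?N) - (x - (x + s j i))"
      unfolding mod_eq_dvd_iff[symmetric] by (rule mod_diff_eq)
    then have "int m dvd (x mod ?N - (x + s j i) mod ?N) + s j i"
      using dvd_trans[of "int m" ?N] by simp
    then have "\<not> int m dvd x mod ?N - (x + s j i) mod ?N"
      using s(2)[OF j i] dvd_add_right_iff by blast
    then show "e \<in> ?E"
      unfolding e using multipartite_edges_iff mn N by (simp add: multipartite_verts_def)
  qed
  define \<H> where "\<H> = {X j t | j t. j \<in> J}"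
  have part: "partition_on ?E \<H>"
  proof (rule partition_onI)
    show "\<Union>\<H> = ?E"
    proof
      show "\<Union>\<H> \<subseteq> ?E" using X_E by (auto simp: \<H>_def)
      show "?E \<subseteq> \<Union>\<H>"
      proof
        fix e assume "e \<in> ?E"
        then obtain x y where e: "e = {x, y}" by (auto simp: multipartite_edges_def)
        then have V: "x \<in> ?V" "y \<in> ?V" and xy: "\<not> int m dvd x - y"
          using \<open>e \<in> ?E\<close> multipartite_edges_iff mn by auto
        have *: "{p, q} \<in> \<Union>\<H>" if pq: "p \<in> ?V" "q \<in> ?V" "j \<in> J" "i < d j" "?N dvd q - p - s j i"
          for p q j i
        proof -
          have "p mod ?N = p" "(p + s j i) mod ?N = q"
          proof -
            have "q mod ?N = (p + s j i) mod ?N"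
              using pq(5) by (simp add: mod_eq_dvd_iff algebra_simps)
            then show "(p + s j i) mod ?N = q" using pq(2) by (simp add: multipartite_verts_def)
          qed (use pq(1) in \<open>simp add: multipartite_verts_def\<close>)
          \<comment> \<open>The translate is chosen so that the base vertex \<open>b j i\<close>
            lands on \<open>p\<close>.\<close>
          then have "{p, q} \<in> X j (p - b j i)"
            unfolding X_def base_edges_def s_def using pq(4)
            by (intro CollectI exI[of _ p] exI[of _ i]) (simp add: s_def)
          then show ?thesis using pq(3) by (auto simp: \<H>_def)
        qed
        define z where "z = (y - x) mod ?N"
        have z: "?N dvd y - x - z" "0 \<le> z" "z < ?N"
          using N by (simp_all add: z_def dvd_minus_mod)
        have mz: "\<not> int m dvd z"
        proof
          assume "int m dvd z"
          moreover have "int m dvd y - x - z" using z(1) by (metis dvd_mult_left of_nat_mult)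
          ultimately have "int m dvd y - x - z + z" by (rule dvd_add[rotated])
          then have "int m dvd y - x" by simp
          then show False using xy by (simp add: dvd_diff_commute)
        qed
        \<comment> \<open>The difference \<open>m * h\<close>, half the modulus, is its own
          negative. It is a multiple of \<open>m\<close>, so either \<open>z\<close> or
          \<open>?N - z\<close> lies strictly below it.\<close>
        have zh: "z \<noteq> int (m * h)" using mz by auto
        obtain j i \<sigma> where ji: "j \<in> J" "i < d j" "?N dvd z - \<sigma> * s j i" "\<sigma> = 1 \<or> \<sigma> = - 1"
        proof (cases "z < int (m * h)")
          case True
          then have "z \<in> B" using z mz by (simp add: B_def)
          then obtain j i where "j \<in> J" "i < d j" "z = \<bar>s j i\<bar>" using BA by (auto simp: A_def)
          then show thesis using that[of j i 1] that[of j i "-1"] by (cases "s j i \<ge> 0") auto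
        next
          case False
          have "int m dvd ?N" by simp
          then have "\<not> int m dvd ?N - z" using mz by (simp add: dvd_diff_right_iff)
          moreover have "0 \<le> ?N - z" "?N - z < int (m * h)" using False z zh N(2) by linarith+
          ultimately have "?N - z \<in> B" by (simp add: B_def)
          then obtain j i where "j \<in> J" "i < d j" "?N - z = \<bar>s j i\<bar>" using BA by (auto simp: A_def)
          moreover have "?N dvd z - (- (?N - z))" by simp
          ultimately show thesis using that[of j i 1] that[of j i "-1"] by (cases "s j i \<ge> 0") auto
        qed
        then have "?N dvd y - x - \<sigma> * s j i"
          using dvd_add[OF z(1) ji(3)] by (simp add: algebra_simps)
        then consider "?N dvd y - x - s j i" | "?N dvd x - y - s j i"
          using ji(4) dvd_minus_iff[of ?N "y - x + s j i"] by (auto simp: algebra_simps)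
        then show "e \<in> \<Union>\<H>"
          using *[OF V ji(1,2)] *[OF V(2,1) ji(1,2)] unfolding e by cases (auto simp: insert_commute)
      qed
    qed
    show "{} \<notin> \<H>"
    proof
      assume "{} \<in> \<H>"
      then obtain j t where j: "j \<in> J" "X j t = {}" by (auto simp: \<H>_def)
      obtain c where c: "length c = m * n" "cycle_edges c = X j t" using X_ham[OF j(1)] by blast
      then have "c \<noteq> []" using mn by auto
      then show False using c j cycle_edges_eq_range by blast
    qed
    fix Y Y' assume Y: "Y \<in> \<H>" "Y' \<in> \<H>" "Y \<noteq> Y'"
    show "disjnt Y Y'"
    proof (rule ccontr)
      assume "\<not> disjnt Y Y'"
      then obtain e where e: "e \<in> Y" "e \<in> Y'" by (auto simp: disjnt_def)
      obtain j t j' t' where j: "j \<in> J" "Y = X j t" "j' \<in> J" "Y' = X j' t'"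
        using Y by (auto simp: \<H>_def)
      obtain x i where x: "e = {x mod ?N, (x + s j i) mod ?N}" "i < d j" "int (d j) dvd x - b j i - t"
        using e j by (auto simp: X_def base_edges_def s_def)
      obtain x' i' where x': "e = {x' mod ?N, (x' + s j' i') mod ?N}" "i' < d j'"
        "int (d j') dvd x' - b j' i' - t'"
        using e j by (auto simp: X_def base_edges_def s_def)
      \<comment> \<open>The common edge is traversed in the same or in opposite directions. The
        first forces equal steps and equal translates, the second is excluded by
        \<open>s_neq\<close>.\<close>
      consider "?N dvd x - x'" "?N dvd (x + s j i) - (x' + s j' i')"
        | "?N dvd x - (x' + s j' i')" "?N dvd (x + s j i) - x'"
        using x(1) x'(1) unfolding mod_eq_dvd_iff[symmetric] by (metis doubleton_eq_iff)
      then show False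
      proof cases
        case 1
        have "?N dvd (x + s j i) - (x' + s j' i') - (x - x')" using 1(2,1) by (rule dvd_diff)
        then have eq: "j = j' \<and> i = i'" using s_eq[OF j(1) x(2) j(3) x'(2)] by simp
        have "int (d j) dvd x - x'" using dvd_trans[OF dN[OF j(1)] 1(1)] .
        then have "int (d j) dvd (x - x') - (x - b j i - t) + (x' - b j i - t')"
          using x(3) x'(3) eq by (metis dvd_add dvd_diff)
        then have "int (d j) dvd t - t'" by simp
        then show False using base_edges_cong j eq Y(3) unfolding X_def by blast
      next
        case 2
        have "?N dvd ((x + s j i) - x') - (x - (x' + s j' i'))" using 2(2,1) by (rule dvd_diff)
        then show False using s_neq[OF j(1) x(2) j(3) x'(2)] by simp
      qed
    qed
  qed
  have hcs: "multipartite_hcs m n \<H>"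
    unfolding multipartite_hcs_def hamiltonian_cycle_system_def
  proof (intro conjI ballI part)
    fix Y assume "Y \<in> \<H>"
    then obtain j t where j: "j \<in> J" "Y = X j t" by (auto simp: \<H>_def)
    obtain c where c: "length c = m * n" "distinct c" "set c = ?V" "cycle_edges c = X j t"
      using X_ham[OF j(1)] by blast
    have "m * n \<ge> 2 * 2" using mn by (intro mult_le_mono) auto
    then have "hamiltonian_cycle ?V ?E c"
      using c X_E[OF j(1)] by (simp add: hamiltonian_cycle_def)
    then show "\<exists>c. hamiltonian_cycle ?V ?E c \<and> Y = cycle_edges c" using c j by blast
  qed
  have tr: "translate_edges m n u (X j t) = X j (t + u)" for u j t
    unfolding X_def by (rule translate_base_edges)
  have "cyclic_hcs m n \<H>"
    unfolding cyclic_hcs_def cycle_edges_map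
  proof (intro conjI hcs allI impI, elim conjE)
    fix c :: "int list" assume "cycle_edges c \<in> \<H>"
    then obtain j t where "j \<in> J" "cycle_edges c = X j t" by (auto simp: \<H>_def)
    then show "translate_edges m n 1 (cycle_edges c) \<in> \<H>" using tr by (auto simp: \<H>_def)
  qed
  moreover have "phi_symmetric_hcs m n \<H>"
    unfolding phi_symmetric_hcs_def cycle_edges_map phi_def
  proof (intro conjI hcs allI impI, elim conjE)
    fix c :: "int list" assume "cycle_edges c \<in> \<H>"
    then obtain j t where j: "j \<in> J" "cycle_edges c = X j t" by (auto simp: \<H>_def)
    have "int (d j) dvd t + int m - t" using d[OF j(1)] by simp
    then have "X j (t + int m) = X j t" unfolding X_def by (rule base_edges_cong)
    then show "translate_edges m n (int m) (cycle_edges c) = cycle_edges c" using tr j by simp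
  qed
  ultimately show ?thesis by blast
qed

section \<open>Construction of the base cycles\<close>

text \<open>This is the path \<open>0, -2 - m * k, 2, -4 - m * k, 4, ...\<close>. The offset
  \<open>m * k\<close> leaves residues modulo \<open>m\<close> alone but enlarges every step, so
  that the first \<open>m div 2 - 1\<close> steps for different \<open>k\<close> use disjoint sets
  of even differences.\<close>

definition zigzag :: "nat \<Rightarrow> nat \<Rightarrow> nat \<Rightarrow> int" where
  "zigzag m k i = (if even i then int i else - int (Suc i) - int (m * k))"

lemma zigzag_0 [simp]: "zigzag m k 0 = 0"
  by (simp add: zigzag_def)

lemma even_zigzag: "even m \<Longrightarrow> even (zigzag m k i)"
  by (simp add: zigzag_def)

lemma abs_zigzag_step: "\<bar>zigzag m k (Suc i) - zigzag m k i\<bar> = int (2 * Suc i + m * k)"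
proof -
  have "zigzag m k (Suc i) - zigzag m k i =
      (if even i then - int (2 * Suc i + m * k) else int (2 * Suc i + m * k))"
    by (simp add: zigzag_def)
  then show ?thesis by (simp del: of_nat_add)
qed

lemma zigzag_inj:
  assumes "i < M" "i' < M" and dvd: "int (2 * M) dvd zigzag (2 * M) k i - zigzag (2 * M) k i'"
  shows "i = i'"
proof -
  \<comment> \<open>For \<open>i < M\<close> this is the least nonnegative residue: even positions
    fall below \<open>M\<close>, odd ones at \<open>M\<close> or above.\<close>
  define r where "r i = (if even i then int i else int (2 * M) - int (Suc i))" for i
  have "zigzag (2 * M) k i - r i = int (2 * M) * (if even i then 0 else - int k - 1)" for i
    by (simp add: zigzag_def r_def algebra_simps)
  then have "int (2 * M) dvd zigzag (2 * M) k i - r i" for i by (metis dvd_triv_left)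
  then have "zigzag (2 * M) k i mod int (2 * M) = r i mod int (2 * M)" for i
    by (simp add: mod_eq_dvd_iff)
  then have "r i mod int (2 * M) = r i' mod int (2 * M)"
    using dvd by (metis mod_eq_dvd_iff)
  moreover have "0 \<le> r i" "r i < int (2 * M)" "0 \<le> r i'" "r i' < int (2 * M)"
    using assms(1,2) by (auto simp: r_def)
  ultimately have "r i = r i'" by simp
  then show ?thesis using assms(1,2) by (auto simp: r_def split: if_splits)
qed

section \<open>Joined paths and paired odd differences\<close>

definition two_paths :: "nat \<Rightarrow> (nat \<Rightarrow> int) \<Rightarrow> int \<Rightarrow> (nat \<Rightarrow> int) \<Rightarrow> nat \<Rightarrow> int" where
  "two_paths M f c g i = (if i < M then f i else c + g (i - M))"

text \<open>The paths keep their own steps. Only the two joining steps involve \<open>c\<close> and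
  \<open>v\<close>, and their sum \<open>2 * M * v - f (M - 1) - g (M - 1)\<close> is independent of
  \<open>c\<close>.\<close>

lemma two_paths_step:
  assumes "M \<ge> 1" and "f 0 = 0" and "g 0 = 0"
  shows "Suc i < M \<Longrightarrow> base_step (2 * M) v (two_paths M f c g) i = f (Suc i) - f i"
    and "Suc i < M \<Longrightarrow> base_step (2 * M) v (two_paths M f c g) (M + i) = g (Suc i) - g i"
    and "base_step (2 * M) v (two_paths M f c g) (M - 1) = c - f (M - 1)"
    and "base_step (2 * M) v (two_paths M f c g) (2 * M - 1) = int (2 * M) * v - c - g (M - 1)"
proof -
  have *: "Suc (M - 1) = M" "\<not> Suc (2 * M - 1) < 2 * M" "\<not> 2 * M - 1 < M" "2 * M - 1 - M = M - 1"
    "M < 2 * M"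
    using assms by auto
  show "Suc i < M \<Longrightarrow> base_step (2 * M) v (two_paths M f c g) i = f (Suc i) - f i"
    "Suc i < M \<Longrightarrow> base_step (2 * M) v (two_paths M f c g) (M + i) = g (Suc i) - g i"
    by (auto simp: base_step_def two_paths_def)
  show "base_step (2 * M) v (two_paths M f c g) (M - 1) = c - f (M - 1)"
    unfolding base_step_def two_paths_def *(1) using assms * by simp
  show "base_step (2 * M) v (two_paths M f c g) (2 * M - 1) = int (2 * M) * v - c - g (M - 1)"
    unfolding base_step_def two_paths_def using assms * by simp
qed

lemma inj_on_modI:
  assumes "\<And>i i'. i < d \<Longrightarrow> i' < d \<Longrightarrow> int d dvd b i - b i' \<Longrightarrow> i = i'"
  shows "inj_on (\<lambda>i. b i mod int d) {..<d}"
  using assms by (auto simp: inj_on_def mod_eq_dvd_iff)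

text \<open>With \<open>c\<close> odd, parity tells the two paths apart, so injectivity can be
  checked on each path separately.\<close>

lemma two_paths_inj:
  assumes f: "\<And>i i'. i < M \<Longrightarrow> i' < M \<Longrightarrow> int (2 * M) dvd f i - f i' \<Longrightarrow> i = i'" "\<And>i. even (f i)"
    and g: "\<And>i i'. i < M \<Longrightarrow> i' < M \<Longrightarrow> int (2 * M) dvd g i - g i' \<Longrightarrow> i = i'" "\<And>i. even (g i)"
    and c: "odd c"
  shows "inj_on (\<lambda>i. two_paths M f c g i mod int (2 * M)) {..<2 * M}"
proof (rule inj_on_modI)
  fix i i' assume i: "i < 2 * M" "i' < 2 * M"
    and dvd: "int (2 * M) dvd two_paths M f c g i - two_paths M f c g i'"
  have "even (int (2 * M))" by simp
  then have "even (two_paths M f c g i - two_paths M f c g i')" using dvd by (rule dvd_trans)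
  then have "i < M \<longleftrightarrow> i' < M"
    using f(2) g(2) c by (auto simp: two_paths_def split: if_splits)
  then consider "i < M" "i' < M" | "i \<ge> M" "i' \<ge> M" by linarith
  then show "i = i'"
  proof cases
    case 1
    then show ?thesis using f(1) dvd by (simp add: two_paths_def)
  next
    case 2
    then have "i - M = i' - M" using g(1)[of "i - M" "i' - M"] dvd i by (simp add: two_paths_def)
    then show ?thesis using 2 by simp
  qed
qed

text \<open>The steps of a base cycle of period 2 with \<open>v = 1\<close> add up to 2, which is
  why neighbouring odd numbers are paired with opposite signs.\<close>

definition edge_pair :: "int \<Rightarrow> nat \<Rightarrow> int" where
  "edge_pair p i = (if i = 0 then 0 else 2 * p + 3)"

lemma edge_pair_step:
  "base_step 2 1 (edge_pair p) 0 = 2 * p + 3" "base_step 2 1 (edge_pair p) (Suc 0) = - (2 * p + 1)"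
  by (simp_all add: base_step_def edge_pair_def)

lemma edge_pair_inj: "inj_on (\<lambda>i. edge_pair p i mod int 2) {..<2}"
proof (rule inj_on_modI)
  fix i i' :: nat assume "i < 2" "i' < 2" "int 2 dvd edge_pair p i - edge_pair p i'"
  then show "i = i'" by (auto simp: edge_pair_def less_2_cases_iff)
qed

text \<open>Division by \<open>2 * M\<close>: the quotient numbers the zigzag, and the nonzero even
  remainder picks its step.\<close>

lemma even_difference_decomp:
  assumes "M \<ge> 1" and x: "0 < x" "x < int (2 * M * h)" "even x" "\<not> int (2 * M) dvd x"
  obtains i k where "Suc i < M" "k < h" "x = int (2 * Suc i + 2 * M * k)"
proof -
  obtain y where y: "x = int y" using x(1) by (metis nonneg_int_cases less_imp_le)
  have y': "y < 2 * M * h" "even y" "\<not> 2 * M dvd y"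
    using x unfolding y by (simp_all only: of_nat_less_iff even_of_nat of_nat_dvd_iff not_False_eq_True)
  define z where "z = y mod (2 * M)"
  have z: "z < 2 * M" "z \<noteq> 0" "even z"
    using assms(1) y' by (auto simp: z_def mod_eq_0_iff_dvd dvd_mod_iff)
  then obtain i where i: "z = 2 * Suc i" by (metis evenE mult_0_right not0_implies_Suc)
  have "y div (2 * M) < h" using y' by (simp add: less_mult_imp_div_less mult.commute)
  moreover have "y = z + 2 * M * (y div (2 * M))" by (simp add: z_def)
  ultimately show thesis using that[of i "y div (2 * M)"] i z y by simp
qed

text \<open>For \<open>M\<close> odd every zigzag ends at \<open>M - 1\<close>, so that two of them can be joined by a pair
  \<open>2 * p + 3, - (2 * p + 1)\<close>; hence all odd differences can be paired alike.\<close>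

lemma hcs_exists_odd_half:
  assumes "odd M" and "h \<ge> 1"
  shows "\<exists>\<H>. cyclic_hcs (2 * M) (2 * h) \<H> \<and> phi_symmetric_hcs (2 * M) (2 * h) \<H>"
proof -
  \<comment> \<open>The \<open>h\<close> zigzags form \<open>q\<close> pairs, with one left over if
    \<open>\<epsilon>\<close> is 1.\<close>
  define q \<epsilon> where "q = h div 2" and "\<epsilon> = h mod 2"
  have h: "h = 2 * q + \<epsilon>" "\<epsilon> = 0 \<or> \<epsilon> = 1" by (auto simp: q_def \<epsilon>_def)
  have M: "M \<ge> 1" using assms(1) by (auto elim: oddE)
  \<comment> \<open>If \<open>\<epsilon>\<close> is 1, the difference 1 is set aside to close the
    leftover zigzag; the remaining odd differences form \<open>P\<close> pairs.\<close>
  define P where "P = (M * h - \<epsilon>) div 2"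
  have P: "2 * P + \<epsilon> = M * h" "q \<le> P"
  proof -
    obtain a where a: "M = 2 * a + 1" using assms(1) by (elim oddE)
    have "M * h - \<epsilon> = 2 * (M * q + a * \<epsilon>)" by (simp add: a h algebra_simps)
    then have P: "P = M * q + a * \<epsilon>" by (simp add: P_def)
    show "2 * P + \<epsilon> = M * h" by (simp add: P a h algebra_simps)
    show "q \<le> P" using M by (simp add: P a)
  qed
  define J where "J = {..<P + \<epsilon>}"
  define p where "p j = int (\<epsilon> + 2 * j)" for j
  define d where "d j = (if j < q then 2 * M else if j < P then 2 else M)" for j
  \<comment> \<open>The zigzags end at \<open>M - 1\<close>, so this choice makes the joining step
    \<open>2 * p j + 3\<close> and the closing step \<open>- (2 * p j + 1)\<close>.\<close>
  define c where "c j = int M - 1 + (2 * p j + 3)" for j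
  define b where "b j = (if j < q
      then two_paths M (zigzag (2 * M) (2 * j)) (c j) (zigzag (2 * M) (2 * j + 1))
      else if j < P then edge_pair (p j) else zigzag (2 * M) (h - 1))" for j
  have end_z: "zigzag (2 * M) k (M - Suc 0) = int M - 1" for k
    using assms(1) M by (simp add: zigzag_def of_nat_diff)
  have step1: "\<bar>base_step (d j) 1 (b j) i\<bar> = int (2 * Suc i + 2 * M * (2 * j))"
    and step2: "\<bar>base_step (d j) 1 (b j) (M + i)\<bar> = int (2 * Suc i + 2 * M * (2 * j + 1))"
    if "j < q" "Suc i < M" for i j
    using that M two_paths_step(1,2)[of M "zigzag (2 * M) (2 * j)" "zigzag (2 * M) (2 * j + 1)" i]
    by (simp_all only: d_def b_def if_True zigzag_0 abs_zigzag_step)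
  have step3: "base_step (d j) 1 (b j) (M - 1) = 2 * p j + 3"
    and step4: "base_step (d j) 1 (b j) (2 * M - 1) = - (2 * p j + 1)"
    if "j < q" for j
    using that M two_paths_step(3,4)[of M "zigzag (2 * M) (2 * j)" "zigzag (2 * M) (2 * j + 1)"]
    by (simp_all add: d_def b_def end_z c_def)
  have step5: "\<bar>base_step (d P) 1 (b P) i\<bar> = int (2 * Suc i + 2 * M * (h - 1))" if "Suc i < M" for i
    using that P abs_zigzag_step[of "2 * M" "h - 1" i] by (simp add: d_def b_def base_step_def)
  have step6: "base_step (d P) 1 (b P) (M - 1) = 1"
    using M P by (simp add: d_def b_def base_step_def end_z)
  have dP: "d P = M" using P by (simp add: d_def)
  show ?thesis
  proof (rule cyclic_symmetric_hcs_from_base_cycles[where J = J and d = d and v = "\<lambda>_. 1" and b = b])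
    show "2 * M \<ge> 2" "2 * h \<ge> 2" "even (2 * h)" "finite J" using M assms(2) by (simp_all add: J_def)
    show "d j \<ge> 1 \<and> d j dvd 2 * M" if "j \<in> J" for j using M by (simp add: d_def)
    show "coprime 1 (int (2 * M * (2 * h) div d j))" for j by simp
    show "inj_on (\<lambda>i. b j i mod int (d j)) {..<d j}" if "j \<in> J" for j
    proof -
      have zz: "inj_on (\<lambda>i. zigzag (2 * M) (h - 1) i mod int M) {..<M}"
      proof (rule inj_on_modI)
        fix i i' assume i: "i < M" "i' < M"
          and dvd: "int M dvd zigzag (2 * M) (h - 1) i - zigzag (2 * M) (h - 1) i'"
        \<comment> \<open>All values are even and \<open>M\<close> is odd, so congruence modulo
          \<open>M\<close> lifts to \<open>2 * M\<close>.\<close>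
        have "even (zigzag (2 * M) (h - 1) i - zigzag (2 * M) (h - 1) i')"
          by (simp add: even_zigzag)
        moreover have "coprime 2 (int M)" using assms(1) by simp
        ultimately have "2 * int M dvd zigzag (2 * M) (h - 1) i - zigzag (2 * M) (h - 1) i'"
          using dvd by (metis divides_mult)
        then show "i = i'" using zigzag_inj[OF i] by simp
      qed
      have "odd (c j)" using assms(1) by (simp add: c_def)
      then have tp: "inj_on (\<lambda>i. two_paths M (zigzag (2 * M) (2 * j)) (c j) (zigzag (2 * M) (2 * j + 1)) i
          mod int (2 * M)) {..<2 * M}"
        using zigzag_inj even_zigzag[of "2 * M"] by (intro two_paths_inj) simp_all
      show ?thesis
        unfolding d_def b_def using tp edge_pair_inj[of "p j"] zz by simp
    qed
    show "\<exists>j\<in>J. \<exists>i<d j. \<bar>base_step (d j) 1 (b j) i\<bar> = x"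
      if x: "0 < x" "2 * x < int (2 * M * (2 * h))" "\<not> int (2 * M) dvd x" for x
    proof (cases "even x")
      case True
      have "x < int (2 * M * h)" using x(2) by simp
      then obtain i k where i: "Suc i < M" "k < h" "x = int (2 * Suc i + 2 * M * k)"
        using even_difference_decomp[OF M x(1) _ True x(3)] by metis
      consider "k = 2 * (k div 2)" "k div 2 < q" | "k = 2 * (k div 2) + 1" "k div 2 < q"
        | "k = h - 1" "\<epsilon> = 1"
        using i(2) h by linarith
      then show ?thesis
      proof cases
        case 1
        then have "k div 2 \<in> J" "i < d (k div 2)" using P i by (auto simp: J_def d_def)
        moreover have "\<bar>base_step (d (k div 2)) 1 (b (k div 2)) i\<bar> = x"
          using step1[OF 1(2) i(1)] i(3) 1(1) by simp
        ultimately show ?thesis by blast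
      next
        case 2
        then have "k div 2 \<in> J" "M + i < d (k div 2)" using P i by (auto simp: J_def d_def)
        moreover have "\<bar>base_step (d (k div 2)) 1 (b (k div 2)) (M + i)\<bar> = x"
          using step2[OF 2(2) i(1)] i(3) by (simp only: 2(1)[symmetric])
        ultimately show ?thesis by blast
      next
        case 3
        then have "P \<in> J" "i < d P" using i dP by (auto simp: J_def)
        moreover have "\<bar>base_step (d P) 1 (b P) i\<bar> = x"
          using step5[OF i(1)] i(3) 3(1) by simp
        ultimately show ?thesis by blast
      qed
    next
      case False
      then obtain y where y: "x = int (2 * y + 1)" using x(1)
        by (metis oddE nonneg_int_cases less_imp_le even_of_nat)
      have yM: "y < M * h"
      proof -
        have "int (2 * (2 * y + 1)) < int (2 * M * (2 * h))" using x(2) y by simp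
        then have "2 * (2 * y + 1) < 2 * M * (2 * h)" by (simp only: of_nat_less_iff)
        then show ?thesis by simp
      qed
      show ?thesis
      proof (cases "y < \<epsilon>")
        case True
        then have "\<epsilon> = 1" "x = 1" using h y by auto
        then have "P \<in> J" "M - 1 < d P" using dP M by (auto simp: J_def)
        moreover have "\<bar>base_step (d P) 1 (b P) (M - 1)\<bar> = x" using step6 \<open>x = 1\<close> by simp
        ultimately show ?thesis by blast
      next
        case False
        define j where "j = (y - \<epsilon>) div 2"
        have j: "y = \<epsilon> + 2 * j \<or> y = \<epsilon> + 2 * j + 1" "j < P"
          using False yM P(1) by (auto simp: j_def)
        have "j \<in> J" using j by (simp add: J_def)
        moreover have "\<exists>i<d j. \<bar>base_step (d j) 1 (b j) i\<bar> = x"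
        proof (cases "j < q")
          case True
          have "M - 1 < d j" "2 * M - 1 < d j" using True M by (auto simp: d_def)
          moreover have "\<bar>base_step (d j) 1 (b j) (2 * M - 1)\<bar> = x \<or> \<bar>base_step (d j) 1 (b j) (M - 1)\<bar> = x"
            using step3[OF True] step4[OF True] j(1) y by (auto simp: p_def)
          ultimately show ?thesis by blast
        next
          case False
          then have "d j = 2" "b j = edge_pair (p j)" using j by (auto simp: d_def b_def)
          moreover have "\<bar>base_step 2 1 (edge_pair (p j)) (Suc 0)\<bar> = x \<or> \<bar>base_step 2 1 (edge_pair (p j)) 0\<bar> = x"
            using edge_pair_step j(1) y by (auto simp: p_def)
          ultimately show ?thesis by (metis lessI zero_less_numeral numeral_2_eq_2)
        qed
        ultimately show ?thesis by blast
      qed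
    qed
    show "2 * (\<Sum>j\<in>J. d j) = (2 * M - 1) * (2 * h)"
    proof -
      have "(\<Sum>j\<in>J. d j) = (\<Sum>j=0..<q. d j) + (\<Sum>j=q..<P. d j) + (\<Sum>j=P..<P + \<epsilon>. d j)"
        using P(2) by (simp add: J_def sum.atLeastLessThan_concat atLeast0LessThan[symmetric])
      also have "\<dots> = q * (2 * M) + (P - q) * 2 + \<epsilon> * M"
        using P(2) by (simp add: d_def)
      finally have "(\<Sum>j\<in>J. d j) + 2 * q + \<epsilon> = 2 * M * q + M * h + \<epsilon> * M"
        using P by simp
      also have "\<dots> = 2 * M * h" using h by (simp add: algebra_simps)
      finally have "(\<Sum>j\<in>J. d j) + h = 2 * M * h" using h by simp
      then have "(\<Sum>j\<in>J. d j) = 2 * M * h - h" by simp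
      then show ?thesis by (simp add: diff_mult_distrib algebra_simps)
    qed
  qed
qed

text \<open>For \<open>M\<close> even the ends of consecutive zigzags differ by \<open>m\<close>, so the joining odd differences must
  sum to \<open>m * (u - 1)\<close> with \<open>u\<close> prime to \<open>n = 4 * q\<close>.  With \<open>u = 2 * q + 1\<close> they are mirror images in the
  range of odd differences, whose middle part is then paired consecutively.\<close>

lemma hcs_exists_even_half:
  assumes "even M" and "M \<ge> 1" and "q \<ge> 1"
  shows "\<exists>\<H>. cyclic_hcs (2 * M) (4 * q) \<H> \<and> phi_symmetric_hcs (2 * M) (4 * q) \<H>"
proof -
  note M = assms(2)
  define J where "J = {..<M * q}"
  have qM: "q \<le> M * q" using M by simp
  then have J: "j \<in> J" if "j < q" for j using that by (simp only: J_def lessThan_iff less_le_trans)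
  \<comment> \<open>The pairs of period 2 start at \<open>p q = q\<close>, because the lowest and
    the highest \<open>q\<close> odd differences serve as joining steps.\<close>
  define p where "p j = 2 * int j - int q" for j
  define d where "d j = (if j < q then 2 * M else 2)" for j :: nat
  define v where "v j = (if j < q then int (2 * q + 1) else 1)" for j :: nat
  \<comment> \<open>This makes the joining step \<open>2 * j + 1\<close>. The second zigzag is
    negated below so that the two end values add up to \<open>2 * M\<close>; with
    \<open>v j = 2 * q + 1\<close> the closing step is then
    \<open>4 * M * q - (2 * j + 1)\<close>.\<close>
  define c where "c j = 2 * int j + 1 - int M - int (2 * M * (2 * j))" for j
  define b where "b j = (if j < q
      then two_paths M (zigzag (2 * M) (2 * j)) (c j) (\<lambda>i. - zigzag (2 * M) (2 * j + 1) i)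
      else edge_pair (p j))" for j
  have end_z: "zigzag (2 * M) k (M - Suc 0) = - int M - int (2 * M * k)" for k
    using assms(1) M by (simp add: zigzag_def)
  have step1: "\<bar>base_step (d j) (v j) (b j) i\<bar> = int (2 * Suc i + 2 * M * (2 * j))"
    if "j < q" "Suc i < M" for i j
    using that M two_paths_step(1)[of M "zigzag (2 * M) (2 * j)" "\<lambda>i. - zigzag (2 * M) (2 * j + 1) i" i]
    by (simp only: d_def b_def if_True zigzag_0 abs_zigzag_step neg_0_equal_iff_equal)
  have step2: "\<bar>base_step (d j) (v j) (b j) (M + i)\<bar> = int (2 * Suc i + 2 * M * (2 * j + 1))"
    if "j < q" "Suc i < M" for i j
  proof -
    have "base_step (d j) (v j) (b j) (M + i) =
        - (zigzag (2 * M) (2 * j + 1) (Suc i) - zigzag (2 * M) (2 * j + 1) i)"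
      using that M two_paths_step(2)[of M "zigzag (2 * M) (2 * j)" "\<lambda>i. - zigzag (2 * M) (2 * j + 1) i" i]
      by (simp add: d_def b_def)
    then show ?thesis by (simp only: abs_minus_cancel abs_zigzag_step)
  qed
  have step3: "base_step (d j) (v j) (b j) (M - 1) = int (2 * j + 1)"
    and step4: "base_step (d j) (v j) (b j) (2 * M - 1) = int (4 * M * q) - int (2 * j + 1)"
    if "j < q" for j
  proof -
    have "base_step (d j) (v j) (b j) (M - 1) = c j - zigzag (2 * M) (2 * j) (M - Suc 0)"
      "base_step (d j) (v j) (b j) (2 * M - 1) =
        int (2 * M) * int (2 * q + 1) - c j + zigzag (2 * M) (2 * j + 1) (M - Suc 0)"
      using that M
        two_paths_step(3,4)[of M "zigzag (2 * M) (2 * j)" "\<lambda>i. - zigzag (2 * M) (2 * j + 1) i"]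
      by (simp_all add: d_def v_def b_def)
    then show "base_step (d j) (v j) (b j) (M - 1) = int (2 * j + 1)"
      "base_step (d j) (v j) (b j) (2 * M - 1) = int (4 * M * q) - int (2 * j + 1)"
      unfolding end_z c_def by (simp_all add: algebra_simps)
  qed
  show ?thesis
  proof (rule cyclic_symmetric_hcs_from_base_cycles[where J = J and d = d and v = v and b = b])
    show "2 * M \<ge> 2" "4 * q \<ge> 2" "even (4 * q)" "finite J" using M assms(3) by (simp_all add: J_def)
    show "d j \<ge> 1 \<and> d j dvd 2 * M" if "j \<in> J" for j using M by (simp add: d_def)
    show "coprime (v j) (int (2 * M * (4 * q) div d j))" for j
    proof (cases "j < q")
      case True
      have "coprime (int (2 * q + 1)) (int (2 * q))"
        using coprime_Suc_left_nat[of "2 * q"] by (simp only: coprime_int_iff Suc_eq_plus1)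
      moreover have "coprime (int (2 * q + 1)) 2" by simp
      ultimately have "coprime (int (2 * q + 1)) (2 * int (2 * q))"
        by (simp only: coprime_mult_right_iff)
      moreover have "int (2 * M * (4 * q) div d j) = 2 * int (2 * q)"
        using True M by (simp add: d_def)
      ultimately show ?thesis using True by (simp only: v_def if_True)
    qed (simp add: v_def)
    show "inj_on (\<lambda>i. b j i mod int (d j)) {..<d j}" if "j \<in> J" for j
    proof -
      have "odd (c j)" using assms(1) by (simp add: c_def)
      moreover have "int (2 * M) dvd - zigzag (2 * M) (2 * j + 1) i - - zigzag (2 * M) (2 * j + 1) i' \<longleftrightarrow>
          int (2 * M) dvd zigzag (2 * M) (2 * j + 1) i' - zigzag (2 * M) (2 * j + 1) i" for i i'
        by simp
      ultimately have "inj_on (\<lambda>i. two_paths M (zigzag (2 * M) (2 * j)) (c j)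
          (\<lambda>i. - zigzag (2 * M) (2 * j + 1) i) i mod int (2 * M)) {..<2 * M}"
        using zigzag_inj even_zigzag[of "2 * M"]
        by (intro two_paths_inj) (simp_all only: even_minus dvd_triv_left, metis+)
      then show ?thesis
        unfolding d_def b_def using edge_pair_inj[of "p j"] by simp
    qed
    show "\<exists>j\<in>J. \<exists>i<d j. \<bar>base_step (d j) (v j) (b j) i\<bar> = x"
      if x: "0 < x" "2 * x < int (2 * M * (4 * q))" "\<not> int (2 * M) dvd x" for x
    proof (cases "even x")
      case True
      have "x < int (2 * M * (2 * q))" using x(2) by simp
      then obtain i k where i: "Suc i < M" "k < 2 * q" "x = int (2 * Suc i + 2 * M * k)"
        using even_difference_decomp[OF M x(1) _ True x(3)] by metis
      define j where "j = k div 2"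
      have j: "k = 2 * j \<or> k = 2 * j + 1" "j < q" using i(2) by (auto simp: j_def)
      have "j \<in> J" using J j by simp
      moreover have "i < d j" "M + i < d j" using i j by (auto simp: d_def)
      moreover have "\<bar>base_step (d j) (v j) (b j) i\<bar> = x \<or> \<bar>base_step (d j) (v j) (b j) (M + i)\<bar> = x"
        using step1[OF j(2) i(1)] step2[OF j(2) i(1)] i(3) j(1) by metis
      ultimately show ?thesis by blast
    next
      case False
      then obtain y where y: "x = int (2 * y + 1)" using x(1)
        by (metis oddE nonneg_int_cases less_imp_le even_of_nat)
      have yM: "y < 2 * (M * q)"
      proof -
        have "int (2 * (2 * y + 1)) < int (2 * M * (4 * q))" using x(2) y by simp
        then have "2 * (2 * y + 1) < 2 * M * (4 * q)" by (simp only: of_nat_less_iff)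
        then show ?thesis by simp
      qed
      consider "y < q" | "2 * (M * q) - q \<le> y" | "q \<le> y" "y < 2 * (M * q) - q" by linarith
      then show ?thesis
      proof cases
        case 1
        then have "y \<in> J" "M - 1 < d y" using J M by (auto simp: d_def)
        moreover have "\<bar>base_step (d y) (v y) (b y) (M - 1)\<bar> = x"
          using step3[OF 1] y by simp
        ultimately show ?thesis by blast
      next
        case 2
        \<comment> \<open>The reflection of \<open>y\<close> in the range below
          \<open>2 * (M * q)\<close> exchanges the differences \<open>2 * j + 1\<close> and
          \<open>4 * M * q - (2 * j + 1)\<close>.\<close>
        define j where "j = 2 * (M * q) - 1 - y"
        have j: "j < q" "y = 2 * (M * q) - 1 - j" "j < 2 * (M * q)"
          using 2 yM assms(3) by (auto simp: j_def)
        then have "j \<in> J" "2 * M - 1 < d j" using J M by (auto simp: d_def)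
        moreover have "\<bar>base_step (d j) (v j) (b j) (2 * M - 1)\<bar> = x"
        proof -
          have "int (2 * y + 1) = int (4 * M * q) - int (2 * j + 1)" using j by simp
          then show ?thesis using step4[OF j(1)] y by simp
        qed
        ultimately show ?thesis by blast
      next
        case 3
        define j where "j = q + (y - q) div 2"
        \<comment> \<open>The middle range has even length, so halving leaves no difference unpaired
          and \<open>j\<close> stays below \<open>M * q\<close>.\<close>
        have "even (2 * (M * q) - q - q)" using qM by simp
        then have j: "q \<le> j" "j < M * q" "y + q = 2 * j \<or> y + q = 2 * j + 1"
          using 3 by (auto simp: j_def)
        then have "d j = 2" "v j = 1" "b j = edge_pair (p j)" by (auto simp: d_def v_def b_def)
        moreover have "\<bar>base_step 2 1 (edge_pair (p j)) (Suc 0)\<bar> = x \<or> \<bar>base_step 2 1 (edge_pair (p j)) 0\<bar> = x"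
        proof -
          have "p j = int y \<or> p j = int y - 1" using j(3) by (auto simp: p_def)
          then show ?thesis using y by (auto simp: edge_pair_step)
        qed
        ultimately have "\<exists>i<d j. \<bar>base_step (d j) (v j) (b j) i\<bar> = x"
          by (metis lessI zero_less_numeral numeral_2_eq_2)
        then show ?thesis using j by (auto simp: J_def)
      qed
    qed
    show "2 * (\<Sum>j\<in>J. d j) = (2 * M - 1) * (4 * q)"
    proof -
      have "(\<Sum>j\<in>J. d j) = (\<Sum>j=0..<q. d j) + (\<Sum>j=q..<M * q. d j)"
        using qM by (simp add: J_def sum.atLeastLessThan_concat atLeast0LessThan[symmetric])
      also have "\<dots> = 2 * (M * q) + 2 * (M * q - q)"
        by (simp add: d_def)
      finally have "(\<Sum>j\<in>J. d j) = 4 * (M * q) - 2 * q" using qM by linarith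
      then show ?thesis by (simp add: diff_mult_distrib algebra_simps)
    qed
  qed
qed

theorem theorem1p1:
  fixes m n :: nat
  assumes "m \<ge> 2" and "even m" and "n \<ge> 1"
  shows "(\<exists>\<H>. cyclic_hcs m n \<H> \<and> phi_symmetric_hcs m n \<H>) \<longleftrightarrow>
         even n \<and> (n mod 4 = 2 \<longrightarrow> m mod 4 = 2)"
proof
  assume "\<exists>\<H>. cyclic_hcs m n \<H> \<and> phi_symmetric_hcs m n \<H>"
  then show "even n \<and> (n mod 4 = 2 \<longrightarrow> m mod 4 = 2)"
    using cyclic_symmetric_hcs_necessary assms by blast
next
  assume *: "even n \<and> (n mod 4 = 2 \<longrightarrow> m mod 4 = 2)"
  obtain M where M: "m = 2 * M" using assms(2) by blast
  obtain h where h: "n = 2 * h" using * by blast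
  show "\<exists>\<H>. cyclic_hcs m n \<H> \<and> phi_symmetric_hcs m n \<H>"
  proof (cases "odd M")
    case True
    then show ?thesis using hcs_exists_odd_half[of M h] assms M h by simp
  next
    case False
    \<comment> \<open>Here \<open>m\<close> is a multiple of 4, so the condition leaves only
      \<open>n\<close> divisible by 4.\<close>
    then have "m mod 4 \<noteq> 2" using M by presburger
    then have "n mod 4 \<noteq> 2" using * by blast
    then have "n = 4 * (n div 4)" using h by presburger
    then show ?thesis
      using hcs_exists_even_half[of M "n div 4"] False assms M
      by (metis One_nat_def Suc_leI mult_0_right neq0_conv not_one_le_zero not_numeral_le_zero)
  qed
qed

end
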